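(* Let $k$ be a field of characteristic zero, $N\ge2$, let $\mathcal{E}_N$ be the Fomin–Kirillov algebra and let $\mathcal{C}$ be the set of 2-cycles in $S_N$. The braided partial derivatives $D_a,\bar D_a:\mathcal{E}_N\to\mathcal{E}_N$, $a\in\mathcal{C}$, are covariant (morphisms in the category of crossed modules) in the sense that $$|D_af|=a|f|\ \ (f\text{ homogeneous of }S_N\text{-degree }|f|),\qquad g.D_a(f)=\zeta_{g,a}\,D_{gag^{-1}}(g.f),\quad\forall g\in S_N,\ f\in\mathcal{E}_N,$$ and similarly for $\bar D_a$. They obey $D_a(e_b)=\bar D_a(e_b)=\delta_{a,b}$ and the braided Leibniz rules $$D_a(fg)=D_a(f)g+f\,\zeta_{|f|^{-1},a}\,D_{|f|^{-1}a|f|}(g),\qquad\bar D_a(fg)=\bar D_a(f)g+(a.f)\bar D_a(g)$$ for all $f,g\in\mathcal{E}_N$, with $f$ of homogeneous $S_N$-degree $|f|$ in the first case.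
   Context: The Fomin–Kirillov algebra $\mathcal{E}_N$ is the associative unital $k$-algebra generated by $[ij]$, $i\neq j\in\{1,\dots,N\}$, with relations $[ij]=-[ji]$, $[ij]^2=0$, $[ij][km]=[km][ij]$, and $[ij][jk]+[jk][ki]+[ki][ij]=0$ for distinct $i,j,k,m$. For $a=(ij)\in\mathcal{C}$ with $i<j$ write $e_a=[ij]$; these form a basis of the degree one part $E_N$. The group $S_N$ acts on $\mathcal{E}_N$ by algebra automorphisms with $g.[ij]=[g(i)\,g(j)]$, and $\mathcal{E}_N$ is $S_N$-graded as an algebra with $|e_a|=a$; this makes it an algebra in the category of left $S_N$-crossed modules (braiding $\Psi(v\otimes w)=|v|.w\otimes v$). The signs $\zeta_{g,b}\in\{\pm1\}$, $g\in S_N$, $b\in\mathcal{C}$, are defined by $g.e_b=\zeta_{g,b}\,e_{gbg^{-1}}$. On generators $\Psi(e_a\otimes e_b)=a.e_b\otimes e_a$. Let $\Psi_{i,i+1}$ denote $\Psi$ acting in positions $i,i+1$ of $E_N^{\otimes m}$ and define the braided integers $[m,\Psi]=\mathrm{id}+\Psi_{12}+\Psi_{12}\Psi_{23}+\cdots+\Psi_{12}\Psi_{23}\cdots\Psi_{m-1,m}$ on $E_N^{\otimes m}$, and similarly $[m,\Psi^{-1}]$ with $\Psi^{-1}$ in place of $\Psi$. Write $M(e_{a_1}\otimes\cdots\otimes e_{a_m})=\sum e_{b_1}\otimes\cdots\otimes e_{b_m}M^{b_1\cdots b_m}_{a_1\cdots a_m}$ for an operator $M$ on $E_N^{\otimes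 m}$. The partial derivatives are the (well-defined) linear maps with $D_a(1)=\bar D_a(1)=0$ and $$D_a(e_{a_1}\cdots e_{a_m})=\sum_{b_2,\dots,b_m}e_{b_2}\cdots e_{b_m}[m,\Psi]^{a\,b_2\cdots b_m}_{a_1\cdots a_m},\qquad \bar D_a(e_{a_1}\cdots e_{a_m})=\sum_{b_2,\dots,b_m}e_{b_2}\cdots e_{b_m}[m,\Psi^{-1}]^{a\,b_2\cdots b_m}_{a_1\cdots a_m}.$$ (Equivalently, $D_a(f)$ is the coefficient of $e_a\otimes$ in $\underline\Delta f$, where $\underline\Delta$ is the braided coproduct on $\mathcal{E}_N$ with $\underline\Delta e_a=e_a\otimes1+1\otimes e_a$.) "Similarly for $\bar D_a$" means $|\bar D_af|=a|f|$ and $g.\bar D_a(f)=\zeta_{g,a}\bar D_{gag^{-1}}(g.f)$. *)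

theory Defs
  imports
    Complex_Main
    "HOL-Library.Poly_Mapping"
    "HOL-Library.Numeral_Type"
    "HOL-Combinatorics.Perm"
begin

unbundle permutation_syntax

text \<open>
  The index set \<open>{1,\<dots>,N}\<close> is the universe of a finite linearly ordered type \<open>'n\<close> with
  \<open>N = CARD('n)\<close>; the class \<open>card2\<close> says \<open>'n\<close> is finite and \<open>CARD('n) \<ge> 2\<close>.
  The group \<open>S\<^sub>N\<close> is \<open>'n perm\<close>, with composition as product.
\<close>

section \<open>Finitely supported functions as free modules\<close>

definition lin_ext :: "('a \<Rightarrow> ('b \<Rightarrow>\<^sub>0 'k::comm_ring_1)) \<Rightarrow> ('a \<Rightarrow>\<^sub>0 'k) \<Rightarrow> ('b \<Rightarrow>\<^sub>0 'k)" where
  "lin_ext f x = (\<Sum>w\<in>Poly_Mapping.keys x. Poly_Mapping.map ((*) (Poly_Mapping.lookup x w)) (f w))"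

lemma lookup_lin_ext:
  "Poly_Mapping.lookup (lin_ext f x) b =
     (\<Sum>w\<in>Poly_Mapping.keys x. Poly_Mapping.lookup x w * Poly_Mapping.lookup (f w) b)"
  by (simp add: lin_ext_def lookup_sum map.rep_eq when_def) (rule sum.cong, auto)

lemma lookup_lin_ext_superset:
  assumes "finite S" "Poly_Mapping.keys x \<subseteq> S"
  shows "Poly_Mapping.lookup (lin_ext f x) b =
     (\<Sum>w\<in>S. Poly_Mapping.lookup x w * Poly_Mapping.lookup (f w) b)"
  unfolding lookup_lin_ext
  by (rule sum.mono_neutral_left) (use assms in \<open>auto simp: in_keys_iff\<close>)

lemma lin_ext_add: "lin_ext f (x + y) = lin_ext f x + lin_ext f y"
proof (rule poly_mapping_eqI)
  fix b
  let ?S = "Poly_Mapping.keys x \<union> Poly_Mapping.keys y"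
  have *: "finite ?S" "Poly_Mapping.keys (x + y) \<subseteq> ?S"
    using Poly_Mapping.keys_add[of x y] by auto
  show "Poly_Mapping.lookup (lin_ext f (x + y)) b = Poly_Mapping.lookup (lin_ext f x + lin_ext f y) b"
    by (simp add: lookup_add lookup_lin_ext_superset[OF *]
        lookup_lin_ext_superset[of ?S x] lookup_lin_ext_superset[of ?S y]
        sum.distrib[symmetric] algebra_simps)
qed

lemma lin_ext_zero [simp]: "lin_ext f 0 = 0"
  by (simp add: lin_ext_def)

lemma lin_ext_uminus: "lin_ext f (- x) = - lin_ext f x"
  by (metis add_eq_0_iff lin_ext_add lin_ext_zero neg_eq_iff_add_eq_0)

lemma lin_ext_diff: "lin_ext f (x - y) = lin_ext f x - lin_ext f y"
  by (metis diff_conv_add_uminus lin_ext_add lin_ext_uminus)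

lemma lin_ext_single: "lin_ext f (Poly_Mapping.single w c) = Poly_Mapping.map ((*) c) (f w)"
  by (rule poly_mapping_eqI)
     (auto simp: lookup_lin_ext map.rep_eq when_def lookup_single)

lemma lin_ext_sum: "lin_ext f (\<Sum>i\<in>A. g i) = (\<Sum>i\<in>A. lin_ext f (g i))"
  by (induction A rule: infinite_finite_induct) (auto simp: lin_ext_add)

lemma poly_mapping_sum_singles:
  "x = (\<Sum>w\<in>Poly_Mapping.keys x. Poly_Mapping.single w (Poly_Mapping.lookup x w))"
  by (rule poly_mapping_eqI)
     (auto simp: lookup_sum lookup_single when_def in_keys_iff sum.delta)

section \<open>Two-sided ideals\<close>

inductive_set two_sided_ideal :: "'r::ring_1 set \<Rightarrow> 'r set" for S where
  zero: "0 \<in> two_sided_ideal S"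
| gen: "r \<in> S \<Longrightarrow> u * r * v \<in> two_sided_ideal S"
| add: "x \<in> two_sided_ideal S \<Longrightarrow> y \<in> two_sided_ideal S \<Longrightarrow> x + y \<in> two_sided_ideal S"

lemma two_sided_ideal_mult_left: "x \<in> two_sided_ideal S \<Longrightarrow> a * x \<in> two_sided_ideal S"
proof (induction rule: two_sided_ideal.induct)
  case (gen r u v)
  then show ?case using two_sided_ideal.gen[of r S "a * u" v] by (simp add: mult.assoc)
qed (auto simp: distrib_left intro: two_sided_ideal.intros)

lemma two_sided_ideal_mult_right: "x \<in> two_sided_ideal S \<Longrightarrow> x * a \<in> two_sided_ideal S"
proof (induction rule: two_sided_ideal.induct)
  case (gen r u v)
  then show ?case using two_sided_ideal.gen[of r S u "v * a"] by (simp add: mult.assoc)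
qed (auto simp: distrib_right intro: two_sided_ideal.intros)

lemma two_sided_ideal_uminus: "x \<in> two_sided_ideal S \<Longrightarrow> - x \<in> two_sided_ideal S"
  using two_sided_ideal_mult_left[of x S "-1"] by simp

lemma two_sided_ideal_diff:
  "x \<in> two_sided_ideal S \<Longrightarrow> y \<in> two_sided_ideal S \<Longrightarrow> x - y \<in> two_sided_ideal S"
  using two_sided_ideal.add two_sided_ideal_uminus by fastforce

section \<open>The Fomin--Kirillov algebra\<close>

text \<open>
  Words are lists, wrapped so that concatenation becomes the addition of a \<open>monoid_add\<close>.
  The convolution product of \<open>Poly_Mapping\<close> then makes \<open>'a word \<Rightarrow>\<^sub>0 'k\<close> the free
  associative unital \<open>'k\<close>-algebra on \<open>'a\<close>.
\<close>

datatype 'a word = Word (letters: "'a list")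

instantiation word :: (type) monoid_add
begin

definition zero_word :: "'a word" where "zero_word = Word []"

definition plus_word :: "'a word \<Rightarrow> 'a word \<Rightarrow> 'a word" where
  "plus_word v w = Word (letters v @ letters w)"

instance
  by standard (auto simp: zero_word_def plus_word_def)

end

typedef (overloaded) 'n symb = "{(i, j) :: 'n::card2 \<times> 'n | i j. i \<noteq> j}"
proof -
  obtain i j :: 'n where "i \<noteq> j"
    using two_le_card[where 'a = 'n] card_le_Suc0_iff_eq[of "UNIV :: 'n set"] by fastforce
  then show ?thesis by blast
qed

setup_lifting type_definition_symb

definition free_br :: "'n::card2 \<Rightarrow> 'n \<Rightarrow> ('n symb word \<Rightarrow>\<^sub>0 'k::field)" where
  "free_br i j = Poly_Mapping.single (Word [Abs_symb (i, j)]) 1"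

definition fk_rels :: "('n::card2 symb word \<Rightarrow>\<^sub>0 'k::field) set" where
  "fk_rels =
     {free_br i j + free_br j i | i j. i \<noteq> j} \<union>
     {free_br i j * free_br i j | i j. i \<noteq> j} \<union>
     {free_br i j * free_br k m - free_br k m * free_br i j | i j k m. distinct [i, j, k, m]} \<union>
     {free_br i j * free_br j k + free_br j k * free_br k i + free_br k i * free_br i j
        | i j k. distinct [i, j, k]}"

lemma fk_ideal_lookup_zero:
  fixes x :: "'n::card2 symb word \<Rightarrow>\<^sub>0 'k::field"
  assumes "x \<in> two_sided_ideal fk_rels"
  shows "Poly_Mapping.lookup x 0 = 0"
proof -
  have word0: "v + w = 0 \<longleftrightarrow> v = 0 \<and> w = 0" for v w :: "'n symb word"
    by (cases v; cases w) (auto simp: zero_word_def plus_word_def)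
  have mult0: "Poly_Mapping.lookup (p * q) 0 = Poly_Mapping.lookup p 0 * Poly_Mapping.lookup q 0"
    for p q :: "'n symb word \<Rightarrow>\<^sub>0 'k"
  proof -
    have eq: "(Poly_Mapping.lookup q r when 0 = l + r) =
        ((Poly_Mapping.lookup q 0 when l = 0) when r = 0)" for l r :: "'n symb word"
    proof (cases "l = 0 \<and> r = 0")
      case True
      then show ?thesis by simp
    next
      case False
      then have "0 \<noteq> l + r" using word0[of l r] by metis
      with False show ?thesis by (auto simp: when_def)
    qed
    show ?thesis
      unfolding lookup_mult eq by (simp add: mult_when)
  qed
  have br0: "Poly_Mapping.lookup (free_br i j :: 'n symb word \<Rightarrow>\<^sub>0 'k) 0 = 0" for i j
    by (simp add: free_br_def lookup_single zero_word_def when_def)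
  from assms show ?thesis
  proof (induction rule: two_sided_ideal.induct)
    case (gen r u v)
    have "Poly_Mapping.lookup r 0 = 0"
      using gen unfolding fk_rels_def
      by (elim UnE CollectE exE conjE) (simp_all only: mult0 br0 lookup_add lookup_minus mult_zero_left diff_self add_0)
    then show ?case by (simp only: mult0 mult_zero_left mult_zero_right)
  next
    case (add x y)
    then show ?case by (simp only: lookup_add add_0)
  qed simp
qed

quotient_type (overloaded) ('n, 'k) fk = "'n::card2 symb word \<Rightarrow>\<^sub>0 'k::field" /
  "\<lambda>x y. x - y \<in> two_sided_ideal fk_rels"
proof (rule equivpI)
  show "reflp (\<lambda>x y :: 'n symb word \<Rightarrow>\<^sub>0 'k. x - y \<in> two_sided_ideal fk_rels)"
    by (rule reflpI) (simp add: two_sided_ideal.zero)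
  show "symp (\<lambda>x y :: 'n symb word \<Rightarrow>\<^sub>0 'k. x - y \<in> two_sided_ideal fk_rels)"
    by (rule sympI) (use two_sided_ideal_uminus in fastforce)
  show "transp (\<lambda>x y :: 'n symb word \<Rightarrow>\<^sub>0 'k. x - y \<in> two_sided_ideal fk_rels)"
  proof (rule transpI)
    fix x y z :: "'n symb word \<Rightarrow>\<^sub>0 'k"
    assume "x - y \<in> two_sided_ideal fk_rels" "y - z \<in> two_sided_ideal fk_rels"
    from two_sided_ideal.add[OF this] show "x - z \<in> two_sided_ideal fk_rels" by simp
  qed
qed

instantiation fk :: (card2, field) ring_1
begin

lift_definition zero_fk :: "('a, 'b) fk" is 0 .

lift_definition one_fk :: "('a, 'b) fk" is 1 .

lift_definition plus_fk :: "('a, 'b) fk \<Rightarrow> ('a, 'b) fk \<Rightarrow> ('a, 'b) fk" is "(+)"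
proof -
  fix x x' y y' :: "'a symb word \<Rightarrow>\<^sub>0 'b"
  assume "x - x' \<in> two_sided_ideal fk_rels" "y - y' \<in> two_sided_ideal fk_rels"
  from two_sided_ideal.add[OF this] show "(x + y) - (x' + y') \<in> two_sided_ideal fk_rels"
    by (simp add: algebra_simps)
qed

lift_definition uminus_fk :: "('a, 'b) fk \<Rightarrow> ('a, 'b) fk" is uminus
proof -
  fix x x' :: "'a symb word \<Rightarrow>\<^sub>0 'b"
  assume "x - x' \<in> two_sided_ideal fk_rels"
  from two_sided_ideal_uminus[OF this] show "- x - - x' \<in> two_sided_ideal fk_rels"
    by (simp add: algebra_simps)
qed

lift_definition minus_fk :: "('a, 'b) fk \<Rightarrow> ('a, 'b) fk \<Rightarrow> ('a, 'b) fk" is "(-)"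
proof -
  fix x x' y y' :: "'a symb word \<Rightarrow>\<^sub>0 'b"
  assume "x - x' \<in> two_sided_ideal fk_rels" "y - y' \<in> two_sided_ideal fk_rels"
  from two_sided_ideal_diff[OF this] show "(x - y) - (x' - y') \<in> two_sided_ideal fk_rels"
    by (simp add: algebra_simps)
qed

lift_definition times_fk :: "('a, 'b) fk \<Rightarrow> ('a, 'b) fk \<Rightarrow> ('a, 'b) fk" is "(*)"
proof -
  fix x x' y y' :: "'a symb word \<Rightarrow>\<^sub>0 'b"
  assume "x - x' \<in> two_sided_ideal fk_rels" "y - y' \<in> two_sided_ideal fk_rels"
  then have "(x - x') * y + x' * (y - y') \<in> two_sided_ideal fk_rels"
    by (intro two_sided_ideal.add two_sided_ideal_mult_left two_sided_ideal_mult_right)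
  then show "x * y - x' * y' \<in> two_sided_ideal fk_rels"
    by (simp add: algebra_simps)
qed

instance
proof
  show "(0 :: ('a, 'b) fk) \<noteq> 1"
  proof transfer
    have "Poly_Mapping.lookup (0 - 1 :: 'a symb word \<Rightarrow>\<^sub>0 'b) 0 \<noteq> 0"
      by (simp add: lookup_minus)
    then show "0 - 1 \<notin> two_sided_ideal (fk_rels :: ('a symb word \<Rightarrow>\<^sub>0 'b) set)"
      using fk_ideal_lookup_zero by blast
  qed
qed (transfer; simp add: algebra_simps two_sided_ideal.zero)+

end

lift_definition fk_scale :: "'k::field \<Rightarrow> ('n::card2, 'k) fk \<Rightarrow> ('n, 'k) fk" is
  "\<lambda>c x. Poly_Mapping.single 0 c * x"
  by (simp add: two_sided_ideal_mult_left flip: right_diff_distrib)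

lift_definition fk_br :: "'n::card2 \<Rightarrow> 'n \<Rightarrow> ('n, 'k::field) fk" is free_br .

section \<open>The action of the symmetric group\<close>

lift_definition symb_act :: "'n::card2 perm \<Rightarrow> 'n symb \<Rightarrow> 'n symb" is
  "\<lambda>g (i, j). (g i, g j)"
  by (auto dest: bij_is_inj injD)

definition word_act :: "'n::card2 perm \<Rightarrow> 'n symb word \<Rightarrow> 'n symb word" where
  "word_act g w = Word (map (symb_act g) (letters w))"

definition free_act ::
    "'n::card2 perm \<Rightarrow> ('n symb word \<Rightarrow>\<^sub>0 'k::field) \<Rightarrow> ('n symb word \<Rightarrow>\<^sub>0 'k)" where
  "free_act g = lin_ext (\<lambda>w. Poly_Mapping.single (word_act g w) 1)"

lemma free_act_single:
  "free_act g (Poly_Mapping.single w c) = Poly_Mapping.single (word_act g w) c"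
  by (simp add: free_act_def lin_ext_single map_single)

lemma word_act_add: "word_act g (v + w) = word_act g v + word_act g w"
  by (simp add: word_act_def plus_word_def)

lemma free_act_mult: "free_act g (x * y) = free_act g x * free_act g y"
proof -
  let ?X = "Poly_Mapping.keys x" and ?Y = "Poly_Mapping.keys y"
  let ?x = "\<lambda>v. Poly_Mapping.single v (Poly_Mapping.lookup x v)"
  let ?y = "\<lambda>w. Poly_Mapping.single w (Poly_Mapping.lookup y w)"
  have sum: "free_act g (sum h A) = (\<Sum>i\<in>A. free_act g (h i))" for h and A :: "'n symb word set"
    by (simp add: free_act_def lin_ext_sum)
  have "free_act g (sum ?x ?X * sum ?y ?Y) = free_act g (sum ?x ?X) * free_act g (sum ?y ?Y)"
    by (simp add: sum_product sum free_act_single mult_single word_act_add)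
  then show ?thesis
    by (simp flip: poly_mapping_sum_singles)
qed

lemma free_act_br:
  "i \<noteq> j \<Longrightarrow> free_act g (free_br i j) = free_br (g \<langle>$\<rangle> i) (g \<langle>$\<rangle> j)"
  by (simp add: free_br_def free_act_single word_act_def symb_act_def Abs_symb_inverse)

lemma free_act_rels:
  fixes r :: "'n::card2 symb word \<Rightarrow>\<^sub>0 'k::field"
  assumes "r \<in> fk_rels"
  shows "free_act g r \<in> fk_rels"
proof -
  have inj: "g \<langle>$\<rangle> i = g \<langle>$\<rangle> j \<longleftrightarrow> i = j" for i j
    by (simp add: inj_eq bij_is_inj)
  have add: "free_act g (x + y) = free_act g x + free_act g y"
    and diff: "free_act g (x - y) = free_act g x - free_act g y"
    for x y :: "'n symb word \<Rightarrow>\<^sub>0 'k"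
    by (simp_all add: free_act_def lin_ext_add lin_ext_diff)
  from assms consider
      i j where "i \<noteq> j" "r = free_br i j + free_br j i"
    | i j where "i \<noteq> j" "r = free_br i j * free_br i j"
    | i j k m where "distinct [i, j, k, m]" "r = free_br i j * free_br k m - free_br k m * free_br i j"
    | i j k where "distinct [i, j, k]"
        "r = free_br i j * free_br j k + free_br j k * free_br k i + free_br k i * free_br i j"
    unfolding fk_rels_def by (elim UnE CollectE exE conjE) presburger+
  then show ?thesis
  proof cases
    case 1
    then have "free_act g r = free_br (g \<langle>$\<rangle> i) (g \<langle>$\<rangle> j) + free_br (g \<langle>$\<rangle> j) (g \<langle>$\<rangle> i)"
      by (simp add: add free_act_br)
    moreover have "g \<langle>$\<rangle> i \<noteq> g \<langle>$\<rangle> j" using 1 inj by blast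
    ultimately show ?thesis unfolding fk_rels_def by blast
  next
    case 2
    then have "free_act g r = free_br (g \<langle>$\<rangle> i) (g \<langle>$\<rangle> j) * free_br (g \<langle>$\<rangle> i) (g \<langle>$\<rangle> j)"
      by (simp add: free_act_mult free_act_br)
    moreover have "g \<langle>$\<rangle> i \<noteq> g \<langle>$\<rangle> j" using 2 inj by blast
    ultimately show ?thesis unfolding fk_rels_def by blast
  next
    case 3
    then have "free_act g r = free_br (g \<langle>$\<rangle> i) (g \<langle>$\<rangle> j) * free_br (g \<langle>$\<rangle> k) (g \<langle>$\<rangle> m)
        - free_br (g \<langle>$\<rangle> k) (g \<langle>$\<rangle> m) * free_br (g \<langle>$\<rangle> i) (g \<langle>$\<rangle> j)"
      by (simp add: diff free_act_mult free_act_br)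
    moreover have "distinct [g \<langle>$\<rangle> i, g \<langle>$\<rangle> j, g \<langle>$\<rangle> k, g \<langle>$\<rangle> m]" using 3 inj by auto
    ultimately show ?thesis unfolding fk_rels_def by blast
  next
    case 4
    then have "i \<noteq> j" "j \<noteq> k" "k \<noteq> i"
      by auto
    with 4 have "free_act g r = free_br (g \<langle>$\<rangle> i) (g \<langle>$\<rangle> j) * free_br (g \<langle>$\<rangle> j) (g \<langle>$\<rangle> k)
        + free_br (g \<langle>$\<rangle> j) (g \<langle>$\<rangle> k) * free_br (g \<langle>$\<rangle> k) (g \<langle>$\<rangle> i)
        + free_br (g \<langle>$\<rangle> k) (g \<langle>$\<rangle> i) * free_br (g \<langle>$\<rangle> i) (g \<langle>$\<rangle> j)"
      by (simp add: add free_act_mult free_act_br)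
    moreover have "distinct [g \<langle>$\<rangle> i, g \<langle>$\<rangle> j, g \<langle>$\<rangle> k]" using 4 inj by auto
    ultimately show ?thesis unfolding fk_rels_def by blast
  qed
qed

lift_definition fk_act :: "'n::card2 perm \<Rightarrow> ('n, 'k::field) fk \<Rightarrow> ('n, 'k) fk" is free_act
proof -
  fix g :: "'n perm" and x y :: "'n symb word \<Rightarrow>\<^sub>0 'k"
  have "free_act g z \<in> two_sided_ideal fk_rels" if "z \<in> two_sided_ideal fk_rels"
    for z :: "'n symb word \<Rightarrow>\<^sub>0 'k"
    using that
  proof (induction rule: two_sided_ideal.induct)
    case zero
    then show ?case by (simp add: free_act_def two_sided_ideal.zero)
  next
    case (gen r u v)
    then show ?case by (simp add: free_act_mult two_sided_ideal.gen free_act_rels)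
  next
    case (add x y)
    then show ?case by (simp add: free_act_def lin_ext_add two_sided_ideal.add)
  qed
  moreover assume "x - y \<in> two_sided_ideal fk_rels"
  ultimately show "free_act g x - free_act g y \<in> two_sided_ideal fk_rels"
    by (metis free_act_def lin_ext_diff)
qed

lemma fk_act_add: "fk_act g (x + y) = fk_act g x + fk_act g y"
  by transfer (simp add: free_act_def lin_ext_add two_sided_ideal.zero)

lemma fk_act_mult: "fk_act g (x * y) = fk_act g x * fk_act g y"
  by transfer (simp add: free_act_mult two_sided_ideal.zero)

lemma fk_act_br: "i \<noteq> j \<Longrightarrow> fk_act g (fk_br i j) = fk_br (g \<langle>$\<rangle> i) (g \<langle>$\<rangle> j)"
  by transfer (simp add: free_act_br two_sided_ideal.zero)

section \<open>Two-cycles, the signs, and the grading\<close>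

typedef (overloaded) 'n cyc2 = "{\<langle>i \<leftrightarrow> j\<rangle> | i j :: 'n::card2. i \<noteq> j}" morphisms perm_of Abs_cyc2
proof -
  obtain i j :: 'n where "i \<noteq> j"
    using two_le_card[where 'a = 'n] card_le_Suc0_iff_eq[of "UNIV :: 'n set"] by fastforce
  then show ?thesis by blast
qed

definition conj2 :: "'n::card2 perm \<Rightarrow> 'n cyc2 \<Rightarrow> 'n cyc2" where
  "conj2 g b = Abs_cyc2 (g * perm_of b * inverse g)"

lemma conj_swap: "g * \<langle>i \<leftrightarrow> j\<rangle> * inverse g = \<langle>g \<langle>$\<rangle> i \<leftrightarrow> g \<langle>$\<rangle> j\<rangle>"
proof (rule perm_eqI)
  fix x
  define y where "y = inverse g \<langle>$\<rangle> x"
  have x: "x = g \<langle>$\<rangle> y"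
    by (simp add: y_def apply_sequence)
  have y: "inverse g \<langle>$\<rangle> (g \<langle>$\<rangle> z) = z" for z
    by (simp add: apply_sequence)
  show "(g * \<langle>i \<leftrightarrow> j\<rangle> * inverse g) \<langle>$\<rangle> x = \<langle>g \<langle>$\<rangle> i \<leftrightarrow> g \<langle>$\<rangle> j\<rangle> \<langle>$\<rangle> x"
    by (cases "y = i"; cases "y = j") (simp_all add: x apply_times y apply_inj)
qed

lemma perm_of_conj2: "perm_of (conj2 g b) = g * perm_of b * inverse g"
proof -
  obtain i j where "perm_of b = \<langle>i \<leftrightarrow> j\<rangle>" "i \<noteq> j"
    using perm_of[of b] by blast
  then have "g * perm_of b * inverse g = \<langle>g \<langle>$\<rangle> i \<leftrightarrow> g \<langle>$\<rangle> j\<rangle>" "g \<langle>$\<rangle> i \<noteq> g \<langle>$\<rangle> j"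
    by (simp_all only: conj_swap apply_inj not_False_eq_True)
  then have "g * perm_of b * inverse g \<in> {\<langle>i \<leftrightarrow> j\<rangle> | i j. i \<noteq> j}"
    by blast
  then show ?thesis
    unfolding conj2_def by (rule Abs_cyc2_inverse)
qed

definition fk_e :: "'n::{card2,linorder} cyc2 \<Rightarrow> ('n, 'k::field) fk" where
  "fk_e a = (THE x. \<exists>i j. i < j \<and> perm_of a = \<langle>i \<leftrightarrow> j\<rangle> \<and> x = fk_br i j)"

definition fk_mono :: "'n::{card2,linorder} cyc2 list \<Rightarrow> ('n, 'k::field) fk" where
  "fk_mono as = prod_list (map fk_e as)"

definition zeta :: "'n::{card2,linorder} perm \<Rightarrow> 'n cyc2 \<Rightarrow> 'k::field" where
  "zeta g b = (THE z. z \<in> {1, -1} \<and>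
     fk_act g (fk_e b) = fk_scale z (fk_e (conj2 g b) :: ('n, 'k) fk))"

text \<open>The elements of \<open>S\<^sub>N\<close>-degree \<open>h\<close>, for the algebra grading with \<open>e\<^sub>a\<close> in degree \<open>a\<close>.\<close>

definition fk_deg :: "'n::{card2,linorder} perm \<Rightarrow> ('n, 'k::field) fk set" where
  "fk_deg h = module.span fk_scale {fk_mono as | as. prod_list (map perm_of as) = h}"

section \<open>Braided integers and partial derivatives\<close>

text \<open>
  The degree one part \<open>E\<^sub>N\<close> has basis \<open>e\<^sub>a\<close>, so tensors are written in coordinates:
  \<open>'n cyc2 \<times> 'n cyc2 \<Rightarrow>\<^sub>0 'k\<close> is the tensor square of \<open>E\<^sub>N\<close>, and \<open>'n cyc2 list \<Rightarrow>\<^sub>0 'k\<close>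
  is the direct sum of all tensor powers, the \<open>m\<close>-th of which is supported on lists of length \<open>m\<close>.
\<close>

definition fk_Psi ::
    "('n::{card2,linorder} cyc2 \<times> 'n cyc2 \<Rightarrow>\<^sub>0 'k::field) \<Rightarrow> ('n cyc2 \<times> 'n cyc2 \<Rightarrow>\<^sub>0 'k)" where
  "fk_Psi = lin_ext (\<lambda>(a, b). Poly_Mapping.single (conj2 (perm_of a) b, a) (zeta (perm_of a) b))"

text \<open>
  \<open>act_at i \<Phi>\<close> applies \<open>\<Phi>\<close> to the tensor factors \<open>i\<close> and \<open>i + 1\<close>, counted from \<open>0\<close>.
  It is only used on tensors of degree at least \<open>i + 2\<close>.
\<close>

definition act_at ::
    "nat \<Rightarrow> (('c \<times> 'c \<Rightarrow>\<^sub>0 'k::field) \<Rightarrow> ('c \<times> 'c \<Rightarrow>\<^sub>0 'k)) \<Rightarrow> ('c list \<Rightarrow>\<^sub>0 'k) \<Rightarrow> ('c list \<Rightarrow>\<^sub>0 'k)"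
  where
  "act_at i \<Phi> = lin_ext (\<lambda>w. lin_ext (\<lambda>(c, d). Poly_Mapping.single (w[i := c, Suc i := d]) 1)
     (\<Phi> (Poly_Mapping.single (w ! i, w ! Suc i) 1)))"

fun braid_chain ::
    "nat \<Rightarrow> (('c \<times> 'c \<Rightarrow>\<^sub>0 'k::field) \<Rightarrow> ('c \<times> 'c \<Rightarrow>\<^sub>0 'k)) \<Rightarrow> ('c list \<Rightarrow>\<^sub>0 'k) \<Rightarrow> ('c list \<Rightarrow>\<^sub>0 'k)"
  where
  "braid_chain 0 \<Phi> = id"
| "braid_chain (Suc r) \<Phi> = braid_chain r \<Phi> \<circ> act_at r \<Phi>"

definition braided_int ::
    "nat \<Rightarrow> (('c \<times> 'c \<Rightarrow>\<^sub>0 'k::field) \<Rightarrow> ('c \<times> 'c \<Rightarrow>\<^sub>0 'k)) \<Rightarrow> ('c list \<Rightarrow>\<^sub>0 'k) \<Rightarrow> ('c list \<Rightarrow>\<^sub>0 'k)"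
  where
  "braided_int m \<Phi> x = (\<Sum>r<m. braid_chain r \<Phi> x)"

definition mat_coeff :: "(('c list \<Rightarrow>\<^sub>0 'k::field) \<Rightarrow> ('c list \<Rightarrow>\<^sub>0 'k)) \<Rightarrow> 'c list \<Rightarrow> 'c list \<Rightarrow> 'k" where
  "mat_coeff M bs as = Poly_Mapping.lookup (M (Poly_Mapping.single as 1)) bs"

definition is_partial ::
    "(('n::{card2,linorder} cyc2 \<times> 'n cyc2 \<Rightarrow>\<^sub>0 'k::field) \<Rightarrow> ('n cyc2 \<times> 'n cyc2 \<Rightarrow>\<^sub>0 'k)) \<Rightarrow>
     'n cyc2 \<Rightarrow> (('n, 'k) fk \<Rightarrow> ('n, 'k) fk) \<Rightarrow> bool" where
  "is_partial \<Phi> a D \<longleftrightarrow>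
     Vector_Spaces.linear fk_scale fk_scale D \<and> D 1 = 0 \<and>
     (\<forall>as. as \<noteq> [] \<longrightarrow>
        D (fk_mono as) =
          (\<Sum>bs | Suc (length bs) = length as.
             fk_scale (mat_coeff (braided_int (length as) \<Phi>) (a # bs) as) (fk_mono bs)))"

text \<open>
  At most one map satisfies \<open>is_partial \<Phi> a\<close>, since the monomials in the \<open>e\<^sub>a\<close> span the
  algebra. That one exists (the formula is compatible with the relations) is not proved here.
\<close>

definition fk_D :: "'n::{card2,linorder} cyc2 \<Rightarrow> ('n, 'k::field) fk \<Rightarrow> ('n, 'k) fk" where
  "fk_D a = (THE D. is_partial fk_Psi a D)"

definition fk_Dbar :: "'n::{card2,linorder} cyc2 \<Rightarrow> ('n, 'k::field) fk \<Rightarrow> ('n, 'k) fk" where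
  "fk_Dbar a = (THE D. is_partial (inv fk_Psi) a D)"

end

theory Submission
  imports Defs
begin

text \<open>
  The \<open>r\<close>-th summand of a braided integer carries the \<open>r\<close>-th factor of a monomial to the front, so
  both derivatives are twisted derivations, determined by their values on the generators. A twisted
  derivation exists on the free algebra and kills a relation times anything, because the braiding
  permutes the terms of each relation; it therefore descends to the Fomin--Kirillov algebra. Since
  monomials span, it is the partial derivative, and every claim becomes an induction on words.
\<close>

section \<open>Generators as ordered pairs\<close>

text \<open>The derivatives and the signs \<open>zeta\<close> are both given by definite
  descriptions, so existence and uniqueness come before any computation. Uniqueness of a sign
  requires \<open>fk_e b\<close> to be nonzero, which the presentation does not show; it follows
  from a derivation that takes the value 1 there. To avoid a circle, derivations are built with
  ordered pairs as indices, without \<open>zeta\<close>, and the signs return only when a pair is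
  normalised to its increasing form. Words are read from both sides. The recursion defining a
  derivation strips the first letter, which suits multiples of relations; a summand of a braided
  integer involves only a prefix of the word, which suits appending a last letter. The Leibniz rules
  connect the two.\<close>

lift_definition flip :: "'n::card2 symb \<Rightarrow> 'n symb" is "\<lambda>(i, j). (j, i)"
  by auto

definition swap_of :: "'n::card2 symb \<Rightarrow> 'n perm" where
  "swap_of s = (case Rep_symb s of (i, j) \<Rightarrow> \<langle>i \<leftrightarrow> j\<rangle>)"

text \<open>The Kronecker delta on 2-cycles, extended to be odd in each argument as
  \<open>[ij] = -[ji]\<close> demands. It becomes the value of the derivative with index
  \<open>p\<close> on the generator \<open>s\<close>.\<close>

definition pairing :: "'n::card2 symb \<Rightarrow> 'n symb \<Rightarrow> 'k::field" where
  "pairing p s = (if s = p then 1 else if s = flip p then -1 else 0)"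

lemma symb_cases:
  fixes s :: "'n::card2 symb"
  obtains i j where "i \<noteq> j" "s = Abs_symb (i, j)"
  by (cases s) auto

lemma Rep_Abs_symb [simp]: "i \<noteq> j \<Longrightarrow> Rep_symb (Abs_symb (i, j)) = (i, j)"
  by (simp add: Abs_symb_inverse)

lemma Abs_symb_eq_iff [simp]:
  "i \<noteq> j \<Longrightarrow> k \<noteq> m \<Longrightarrow> Abs_symb (i, j) = Abs_symb (k, m) \<longleftrightarrow> i = k \<and> j = m"
  by (metis Rep_Abs_symb prod.inject)

lemma flip_Abs [simp]: "i \<noteq> j \<Longrightarrow> flip (Abs_symb (i, j)) = Abs_symb (j, i)"
  by (simp add: flip_def)

lemma swap_of_Abs [simp]: "i \<noteq> j \<Longrightarrow> swap_of (Abs_symb (i, j)) = \<langle>i \<leftrightarrow> j\<rangle>"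
  by (simp add: swap_of_def)

lemma symb_act_Abs [simp]:
  "i \<noteq> j \<Longrightarrow> symb_act g (Abs_symb (i, j)) = Abs_symb (g \<langle>$\<rangle> i, g \<langle>$\<rangle> j)"
  by (simp add: symb_act_def)

lemma flip_flip [simp]: "flip (flip s) = s"
  by (cases s rule: symb_cases) simp

lemma flip_neq [simp]: "flip s \<noteq> s" "s \<noteq> flip s"
  by (cases s rule: symb_cases; simp)+

lemma flip_eq_iff [simp]: "flip s = flip t \<longleftrightarrow> s = t"
  by (metis flip_flip)

lemma swap_of_flip [simp]: "swap_of (flip s) = swap_of s"
  by (cases s rule: symb_cases) (simp add: swap_sym)

lemma symb_act_flip [simp]: "symb_act g (flip s) = flip (symb_act g s)"
  by (cases s rule: symb_cases) (simp add: apply_inj)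

lemma symb_act_one [simp]: "symb_act 1 s = s"
  by (cases s rule: symb_cases) simp

lemma symb_act_mult: "symb_act (g * h) s = symb_act g (symb_act h s)"
  by (cases s rule: symb_cases) (simp add: apply_inj apply_times)

lemma symb_act_eq_iff [simp]: "symb_act g s = symb_act g t \<longleftrightarrow> s = t"
  by (cases s rule: symb_cases; cases t rule: symb_cases) (simp add: apply_inj)

lemma symb_act_swap_of_self [simp]: "symb_act (swap_of s) s = flip s"
  by (cases s rule: symb_cases) simp

lemma swap_of_symb_act: "swap_of (symb_act g s) = g * swap_of s * inverse g"
  by (cases s rule: symb_cases) (simp add: conj_swap apply_inj)

lemma swap_of_mult_self [simp]: "swap_of s * swap_of s = 1"
  by (cases s rule: symb_cases) simp

lemma swap_of_mult_left_self [simp]: "swap_of s * (swap_of s * g) = g"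
  by (simp flip: mult.assoc)

lemma inverse_swap_of [simp]: "inverse (swap_of s) = swap_of s"
  by (cases s rule: symb_cases) simp

lemma swap_eq_swapD:
  assumes "i \<noteq> j" "\<langle>i \<leftrightarrow> j\<rangle> = \<langle>k \<leftrightarrow> m\<rangle>"
  shows "i = k \<and> j = m \<or> i = m \<and> j = k"
  using assms by (metis apply_swap_same apply_swap_simp)

lemma swap_of_eq_iff: "swap_of s = swap_of t \<longleftrightarrow> s = t \<or> s = flip t"
  by (cases s rule: symb_cases; cases t rule: symb_cases)
    (auto dest: swap_eq_swapD simp: swap_sym)

lemma pairing_flip_left [simp]: "pairing (flip p) s = - pairing p s"
  by (simp add: pairing_def)

lemma pairing_flip_right [simp]: "pairing p (flip s) = - pairing p s"
  by (auto simp: pairing_def)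

lemma pairing_self [simp]: "pairing p p = 1"
  by (simp add: pairing_def)

lemma pairing_symb_act [simp]: "pairing (symb_act g p) (symb_act g s) = pairing p s"
  by (simp add: pairing_def flip: symb_act_flip)

lemma pairing_symb_act_left: "pairing (symb_act g p) s = pairing p (symb_act (inverse g) s)"
  by (metis pairing_symb_act symb_act_mult symb_act_one perm.left_inverse)

lemma pairing_nonzero: "pairing p s \<noteq> 0 \<Longrightarrow> swap_of p = swap_of s"
  by (auto simp: pairing_def split: if_splits)

section \<open>The algebra structure\<close>

lemma poly_mapping_single_induct [case_names single add]:
  fixes x :: "'a \<Rightarrow>\<^sub>0 'k::comm_ring_1"
  assumes "\<And>w c. P (Poly_Mapping.single w c)"
    and "\<And>x y. P x \<Longrightarrow> P y \<Longrightarrow> P (x + y)"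
  shows "P x"
proof -
  have "P (\<Sum>w\<in>A. Poly_Mapping.single w (c w))" if "finite A" for A :: "'a set" and c
    using that
  proof induction
    case empty
    show ?case using assms(1)[of _ 0] by simp
  next
    case (insert w A)
    then show ?case by (simp add: assms)
  qed
  from this[of "Poly_Mapping.keys x" "Poly_Mapping.lookup x"] show ?thesis
    by (simp flip: poly_mapping_sum_singles)
qed

lemma free_induct [case_names single add]:
  fixes x :: "'a word \<Rightarrow>\<^sub>0 'k::field"
  assumes "\<And>ss c. P (Poly_Mapping.single (Word ss) c)"
    and "\<And>x y. P x \<Longrightarrow> P y \<Longrightarrow> P (x + y)"
  shows "P x"
proof (induction x rule: poly_mapping_single_induct)
  case (single w c)
  then show ?case using assms(1) by (cases w) simp
qed (rule assms(2))

lemma single_zero_commutes: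
  fixes x :: "'a word \<Rightarrow>\<^sub>0 'k::field"
  shows "Poly_Mapping.single 0 c * x = x * Poly_Mapping.single 0 c"
proof (induction x rule: poly_mapping_single_induct)
  case (single w d)
  then show ?case by (simp add: mult_single mult.commute)
next
  case (add x y)
  then show ?case by (simp add: distrib_left distrib_right)
qed

interpretation fk: vector_space "fk_scale :: 'k::field \<Rightarrow> ('n::card2, 'k) fk \<Rightarrow> _"
proof
  fix c d :: 'k and x y :: "('n, 'k) fk"
  show "fk_scale c (x + y) = fk_scale c x + fk_scale c y"
    by transfer (simp add: distrib_left two_sided_ideal.zero)
  show "fk_scale (c + d) x = fk_scale c x + fk_scale d x"
    by transfer (simp add: single_add distrib_right two_sided_ideal.zero)
  show "fk_scale c (fk_scale d x) = fk_scale (c * d) x"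
    by transfer (simp add: mult_single two_sided_ideal.zero flip: mult.assoc)
  show "fk_scale 1 x = x"
    by transfer (simp add: two_sided_ideal.zero)
qed

lemma fk_linear_iff:
  fixes F :: "('n::card2, 'k::field) fk \<Rightarrow> ('n, 'k) fk"
  shows "Vector_Spaces.linear fk_scale fk_scale F \<longleftrightarrow>
    (\<forall>x y. F (x + y) = F x + F y) \<and> (\<forall>c x. F (fk_scale c x) = fk_scale c (F x))"
  by (simp add: Vector_Spaces.linear_iff fk.vector_space_axioms)

lemma fk_scale_mult_left [simp]: "fk_scale c x * y = fk_scale c (x * y)"
  by transfer (simp add: mult.assoc two_sided_ideal.zero)

lemma fk_scale_mult_right [simp]: "x * fk_scale c y = fk_scale c (x * y)"
proof transfer
  fix x y :: "'a symb word \<Rightarrow>\<^sub>0 'b" and c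
  have "x * (Poly_Mapping.single 0 c * y) = Poly_Mapping.single 0 c * (x * y)"
    by (metis mult.assoc single_zero_commutes)
  then show "x * (Poly_Mapping.single 0 c * y) - Poly_Mapping.single 0 c * (x * y)
      \<in> two_sided_ideal fk_rels"
    by (simp add: two_sided_ideal.zero)
qed

lemma abs_fk_add: "abs_fk (x + y) = abs_fk x + abs_fk y"
  and abs_fk_diff: "abs_fk (x - y) = abs_fk x - abs_fk y"
  and abs_fk_mult: "abs_fk (x * y) = abs_fk x * abs_fk y"
  by (simp_all only: plus_fk.abs_eq minus_fk.abs_eq times_fk.abs_eq)

lemma abs_fk_zero [simp]: "abs_fk 0 = 0"
  by (simp only: zero_fk_def)

lemma abs_fk_eq_zero_iff: "abs_fk x = 0 \<longleftrightarrow> x \<in> two_sided_ideal fk_rels"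
  using fk.abs_eq_iff[of x 0] by simp

definition free_gen :: "'n::card2 symb \<Rightarrow> ('n symb word \<Rightarrow>\<^sub>0 'k::field)" where
  "free_gen s = Poly_Mapping.single (Word [s]) 1"

definition fk_gen :: "'n::card2 symb \<Rightarrow> ('n, 'k::field) fk" where
  "fk_gen s = abs_fk (free_gen s)"

definition fk_word :: "'n::card2 symb list \<Rightarrow> ('n, 'k::field) fk" where
  "fk_word ss = prod_list (map fk_gen ss)"

lemma fk_word_Nil [simp]: "fk_word [] = 1"
  and fk_word_Cons [simp]: "fk_word (s # ss) = fk_gen s * fk_word ss"
  and fk_word_append [simp]: "fk_word (ss @ ts) = fk_word ss * fk_word ts"
  by (simp_all add: fk_word_def)

lemma single_Word_Cons:
  "Poly_Mapping.single (Word (s # ss)) c = free_gen s * Poly_Mapping.single (Word ss) c"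
  by (simp add: free_gen_def mult_single plus_word_def)

lemma abs_fk_single: "abs_fk (Poly_Mapping.single (Word ss) c) = fk_scale c (fk_word ss)"
proof (induction ss)
  case Nil
  have "abs_fk (Poly_Mapping.single (Word []) c) = fk_scale c (abs_fk 1)"
    by (simp add: fk_scale.abs_eq flip: zero_word_def)
  then show ?case by (simp add: one_fk_def)
next
  case (Cons s ss)
  then show ?case
    by (simp add: single_Word_Cons abs_fk_mult fk_gen_def)
qed

lemma fk_induct [case_names word add]:
  fixes f :: "('n::card2, 'k::field) fk"
  assumes "\<And>ss c. P (fk_scale c (fk_word ss))"
    and "\<And>x y. P x \<Longrightarrow> P y \<Longrightarrow> P (x + y)"
  shows "P f"
proof (induction f rule: fk.abs_induct)
  case (1 x)
  then show ?case
    by (induction x rule: free_induct) (simp_all add: abs_fk_single abs_fk_add assms)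
qed

text \<open>Keeps of each relation only what a derivation sees: how the transposition of one letter
  acts on another. In the three-term case the letters are \<open>(i, j)\<close>,
  \<open>(j, k)\<close>, \<open>(k, i)\<close>, and the transposition of each sends the next one to
  the reverse of the third.\<close>

lemma fk_rels_cases:
  fixes r :: "'n::card2 symb word \<Rightarrow>\<^sub>0 'k::field"
  assumes "r \<in> fk_rels"
  obtains
    (skew) s where "r = free_gen s + free_gen (flip s)"
  | (square) s where "r = free_gen s * free_gen s"
  | (commute) s t where "symb_act (swap_of s) t = t" "symb_act (swap_of t) s = s"
      "r = free_gen s * free_gen t - free_gen t * free_gen s"
  | (braid) s t u where "symb_act (swap_of s) t = flip u" "symb_act (swap_of t) u = flip s"
      "symb_act (swap_of u) s = flip t"
      "r = free_gen s * free_gen t + free_gen t * free_gen u + free_gen u * free_gen s"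
proof -
  have br: "free_br i j = free_gen (Abs_symb (i, j))" for i j :: 'n
    by (simp add: free_br_def free_gen_def)
  from assms consider
      i j where "i \<noteq> j" "r = free_br i j + free_br j i"
    | i j where "i \<noteq> j" "r = free_br i j * free_br i j"
    | i j k m where "distinct [i, j, k, m]" "r = free_br i j * free_br k m - free_br k m * free_br i j"
    | i j k where "distinct [i, j, k]"
        "r = free_br i j * free_br j k + free_br j k * free_br k i + free_br k i * free_br i j"
    unfolding fk_rels_def by (elim UnE CollectE exE conjE) presburger+
  then show thesis
  proof cases
    case (1 i j)
    then show thesis using skew[of "Abs_symb (i, j)"] by (simp add: br)
  next
    case 2
    then show thesis using square by (simp add: br)
  next
    case (3 i j k m)
    then have "\<langle>i \<leftrightarrow> j\<rangle> \<langle>$\<rangle> k = k" "\<langle>i \<leftrightarrow> j\<rangle> \<langle>$\<rangle> m = m" "\<langle>k \<leftrightarrow> m\<rangle> \<langle>$\<rangle> i = i" "\<langle>k \<leftrightarrow> m\<rangle> \<langle>$\<rangle> j = j"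
      by auto
    with 3 show thesis using commute[of "Abs_symb (i, j)" "Abs_symb (k, m)"] by (simp add: br)
  next
    case (4 i j k)
    then have "i \<noteq> j" "j \<noteq> i" "j \<noteq> k" "k \<noteq> j" "k \<noteq> i" "i \<noteq> k" by auto
    note neq = this
    show thesis
    proof (rule braid)
      show "r = free_gen (Abs_symb (i, j)) * free_gen (Abs_symb (j, k))
          + free_gen (Abs_symb (j, k)) * free_gen (Abs_symb (k, i))
          + free_gen (Abs_symb (k, i)) * free_gen (Abs_symb (i, j))"
        using 4(2) by (simp only: br)
    qed (simp_all add: neq)
  qed
qed

lemma rel_in_ideal: "r \<in> S \<Longrightarrow> r \<in> two_sided_ideal S"
  using two_sided_ideal.gen[of r S 1 1] by simp

lemma fk_gen_flip [simp]: "fk_gen (flip s) = - (fk_gen s :: ('n::card2, 'k::field) fk)"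
proof -
  obtain i j where s: "i \<noteq> j" "s = Abs_symb (i, j)"
    by (rule symb_cases)
  then have "free_gen s + free_gen (flip s) = (free_br i j + free_br j i :: 'n symb word \<Rightarrow>\<^sub>0 'k)"
    by (simp add: free_br_def free_gen_def)
  with s(1) have "free_gen s + free_gen (flip s) \<in> (fk_rels :: ('n symb word \<Rightarrow>\<^sub>0 'k) set)"
    unfolding fk_rels_def by blast
  then have "abs_fk (free_gen s + free_gen (flip s)) = (0 :: ('n, 'k) fk)"
    by (simp add: abs_fk_eq_zero_iff rel_in_ideal)
  then show ?thesis
    by (simp add: fk_gen_def abs_fk_add minus_equation_iff eq_neg_iff_add_eq_0 add.commute)
qed

lemma fk_act_zero [simp]: "fk_act g 0 = 0"
  using fk_act_add[of g 0 0] by simp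

lemma fk_act_scale: "fk_act g (fk_scale c f) = fk_scale c (fk_act g f)"
proof transfer
  fix g :: "'n::card2 perm" and c :: "'k::field" and f :: "'n symb word \<Rightarrow>\<^sub>0 'k"
  have "free_act g (Poly_Mapping.single 0 c * f) = Poly_Mapping.single 0 c * free_act g f"
    by (simp add: free_act_mult free_act_single word_act_def zero_word_def)
  then show "free_act g (Poly_Mapping.single 0 c * f) - Poly_Mapping.single 0 c * free_act g f
      \<in> two_sided_ideal fk_rels"
    by (simp add: two_sided_ideal.zero)
qed

lemma fk_act_gen [simp]: "fk_act g (fk_gen s) = fk_gen (symb_act g s)"
  by (simp add: fk_gen_def free_gen_def fk_act.abs_eq free_act_single word_act_def)

lemma fk_act_one [simp]: "fk_act g 1 = 1"
proof -
  have "fk_act g (abs_fk (Poly_Mapping.single 0 1)) = abs_fk (Poly_Mapping.single 0 1)"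
    by (simp add: fk_act.abs_eq free_act_single word_act_def zero_word_def del: single_one)
  then show ?thesis
    by (simp flip: one_fk_def)
qed

section \<open>Twisted derivations indexed by ordered pairs\<close>

text \<open>
  Moving the index \<open>p\<close> of a derivative past a generator \<open>s\<close> uses the braiding
  \<open>(p, s) \<mapsto> (s, s \<cdot> p)\<close> for \<open>D\<close> (flag \<^term>\<open>True\<close>) and its inverse
  \<open>(p, s) \<mapsto> (p \<cdot> s, p)\<close> for the conjugate derivative (flag \<^term>\<open>False\<close>), where a pair acts
  through its transposition. Indexing by ordered pairs instead of 2-cycles makes every sign
  \<open>\<zeta>\<close> disappear.
\<close>

definition move_gen :: "bool \<Rightarrow> 'n::card2 symb \<Rightarrow> 'n symb \<Rightarrow> 'n symb" where
  "move_gen e p s = (if e then s else symb_act (swap_of p) s)"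

definition move_idx :: "bool \<Rightarrow> 'n::card2 symb \<Rightarrow> 'n symb \<Rightarrow> 'n symb" where
  "move_idx e p s = (if e then symb_act (swap_of s) p else p)"

text \<open>The twisted Leibniz rule read as a recursion on the first letter. Values are taken in
  the quotient, so the relations may already be used in them.\<close>

fun word_deriv :: "bool \<Rightarrow> 'n::card2 symb \<Rightarrow> 'n symb list \<Rightarrow> ('n, 'k::field) fk" where
  "word_deriv e p [] = 0"
| "word_deriv e p (s # ss) = fk_scale (pairing p s) (fk_word ss)
     + fk_gen (move_gen e p s) * word_deriv e (move_idx e p s) ss"

text \<open>\<open>lin_ext\<close> produces finitely supported functions, whereas the values here
  lie in \<open>fk\<close>; hence the linear extension is written out.\<close>

definition free_deriv :: "bool \<Rightarrow> 'n::card2 symb \<Rightarrow> ('n symb word \<Rightarrow>\<^sub>0 'k::field) \<Rightarrow> ('n, 'k) fk" where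
  "free_deriv e p x =
     (\<Sum>w\<in>Poly_Mapping.keys x. fk_scale (Poly_Mapping.lookup x w) (word_deriv e p (letters w)))"

lemma free_deriv_superset:
  assumes "finite S" "Poly_Mapping.keys x \<subseteq> S"
  shows "free_deriv e p x = (\<Sum>w\<in>S. fk_scale (Poly_Mapping.lookup x w) (word_deriv e p (letters w)))"
  unfolding free_deriv_def
  by (rule sum.mono_neutral_left) (use assms in \<open>auto simp: in_keys_iff\<close>)

lemma free_deriv_zero [simp]: "free_deriv e p 0 = 0"
  by (simp add: free_deriv_def)

lemma free_deriv_add: "free_deriv e p (x + y) = free_deriv e p x + free_deriv e p y"
proof -
  let ?S = "Poly_Mapping.keys x \<union> Poly_Mapping.keys y"
  have S: "finite ?S" "Poly_Mapping.keys (x + y) \<subseteq> ?S"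
    using Poly_Mapping.keys_add[of x y] by auto
  show ?thesis
    by (simp add: free_deriv_superset[OF S] free_deriv_superset[of ?S x] free_deriv_superset[of ?S y]
        lookup_add fk.scale_left_distrib sum.distrib)
qed

lemma free_deriv_diff: "free_deriv e p (x - y) = free_deriv e p x - free_deriv e p y"
  by (metis add_diff_cancel_right' diff_add_cancel free_deriv_add)

lemma free_deriv_single:
  "free_deriv e p (Poly_Mapping.single (Word ss) c) = fk_scale c (word_deriv e p ss)"
  by (simp add: free_deriv_def)

lemma free_deriv_gen_mult:
  "free_deriv e p (free_gen s * y) = fk_scale (pairing p s) (abs_fk y)
     + fk_gen (move_gen e p s) * free_deriv e (move_idx e p s) y"
proof (induction y rule: free_induct)
  case (single ss c)
  show ?case
    by (simp add: free_deriv_single abs_fk_single fk.scale_right_distrib mult.commute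
        flip: single_Word_Cons)
next
  case (add x y)
  then show ?case
    by (simp add: distrib_left free_deriv_add abs_fk_add fk.scale_right_distrib algebra_simps)
qed

text \<open>The three terms of the braid relation have the same degree, a 3-cycle. Passing any of
  them therefore moves the index of the derivative to the same place.\<close>

lemma swap_of_triple:
  assumes "symb_act (swap_of s) t = flip u" "symb_act (swap_of t) u = flip s"
  shows "swap_of t * swap_of s = swap_of u * swap_of t"
    "swap_of s * swap_of u = swap_of u * swap_of t"
proof -
  have "swap_of s = swap_of t * swap_of u * swap_of t"
    using swap_of_symb_act[of "swap_of t" u] assms(2) by simp
  then show *: "swap_of t * swap_of s = swap_of u * swap_of t"
    by (simp add: mult.assoc)
  have "swap_of u = swap_of s * swap_of t * swap_of s"
    using swap_of_symb_act[of "swap_of s" t] assms(1) by simp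
  then have "swap_of s * swap_of u = swap_of t * swap_of s"
    by (simp add: mult.assoc)
  with * show "swap_of s * swap_of u = swap_of u * swap_of t"
    by simp
qed

text \<open>For the conjugate derivative the right letter of a product acts on the left one, the
  opposite of what the True case uses; the involution property converts one into the other.\<close>

lemma symb_act_swap_flipD:
  assumes "symb_act (swap_of t) u = flip s"
  shows "symb_act (swap_of t) s = flip u"
proof -
  have "u = symb_act (swap_of t) (flip s)"
    by (simp flip: assms symb_act_mult)
  then show ?thesis by simp
qed

lemma swap_of_commuting:
  assumes "symb_act (swap_of s) t = t"
  shows "swap_of s * swap_of t = swap_of t * swap_of s"
proof -
  have "swap_of t = swap_of s * swap_of t * swap_of s"
    using swap_of_symb_act[of "swap_of s" t] assms by simp
  then show ?thesis
    by (metis mult.assoc mult_1_right swap_of_mult_self)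
qed

text \<open>The derivative hits the first letter, hits the second, or passes both. In the False case
  the middle term first carries \<open>swap_of p\<close>; it may be replaced by
  \<open>swap_of t\<close> because \<open>pairing p t\<close> vanishes unless the two transpositions
  agree.\<close>

lemma free_deriv_gen_gen_mult:
  fixes y :: "'n::card2 symb word \<Rightarrow>\<^sub>0 'k::field"
  shows "free_deriv True p (free_gen s * free_gen t * y) =
      fk_scale (pairing p s) (fk_gen t * abs_fk y)
      + fk_scale (pairing p (symb_act (swap_of s) t)) (fk_gen s * abs_fk y)
      + fk_gen s * fk_gen t * free_deriv True (symb_act (swap_of t * swap_of s) p) y"
    and "free_deriv False p (free_gen s * free_gen t * y) =
      fk_scale (pairing p s) (fk_gen t * abs_fk y)
      + fk_scale (pairing p t) (fk_gen (symb_act (swap_of t) s) * abs_fk y)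
      + fk_act (swap_of p) (fk_gen s * fk_gen t) * free_deriv False p y"
  by (simp_all add: mult.assoc free_deriv_gen_mult abs_fk_mult move_gen_def move_idx_def
      symb_act_mult pairing_symb_act_left distrib_left fk_act_mult flip: fk_gen_def)
    (metis pairing_nonzero)

text \<open>Terms in which the derivative hits a letter of \<open>r\<close> cancel in pairs. For a
  quadratic relation, what is left is \<open>r\<close>, possibly moved by \<open>swap_of p\<close>,
  times a derivative of \<open>y\<close>, and \<open>r\<close> is zero in the quotient.\<close>

lemma free_deriv_rel_mult:
  fixes r :: "'n::card2 symb word \<Rightarrow>\<^sub>0 'k::field"
  assumes "r \<in> fk_rels"
  shows "free_deriv e p (r * y) = 0"
proof -
  have *: "abs_fk r = 0"
    by (simp add: assms abs_fk_eq_zero_iff rel_in_ideal)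
  from assms show ?thesis
  proof (cases rule: fk_rels_cases)
    case (skew s)
    then show ?thesis
      by (cases e) (simp_all add: distrib_right free_deriv_add free_deriv_gen_mult move_gen_def move_idx_def)
  next
    case (square s)
    with * have "fk_gen s * fk_gen s = (0 :: ('n, 'k) fk)"
      by (simp add: fk_gen_def abs_fk_mult)
    with square show ?thesis
      by (cases e) (simp_all add: free_deriv_gen_gen_mult)
  next
    case (commute s t)
    with * have "fk_gen s * fk_gen t = (fk_gen t * fk_gen s :: ('n, 'k) fk)"
      by (simp add: fk_gen_def abs_fk_mult abs_fk_diff)
    with commute show ?thesis
      by (cases e) (simp_all add: left_diff_distrib free_deriv_diff free_deriv_gen_gen_mult
          swap_of_commuting)
  next
    case (braid s t u)
    with * have rel: "fk_gen s * fk_gen t + fk_gen t * fk_gen u + fk_gen u * fk_gen s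
        = (0 :: ('n, 'k) fk)"
      by (simp add: fk_gen_def abs_fk_mult abs_fk_add)
    show ?thesis
    proof (cases e)
      case True
      let ?g = "swap_of t * swap_of s"
      have "free_deriv e p (r * y) =
          (fk_gen s * fk_gen t + fk_gen t * fk_gen u + fk_gen u * fk_gen s)
          * free_deriv True (symb_act ?g p) y"
        using True braid swap_of_triple[of s t u]
        by (simp add: distrib_right free_deriv_add free_deriv_gen_gen_mult)
      then show ?thesis by (simp add: rel)
    next
      case False
      have "free_deriv e p (r * y) =
          fk_act (swap_of p) (fk_gen s * fk_gen t + fk_gen t * fk_gen u + fk_gen u * fk_gen s)
          * free_deriv False p y"
        using False braid braid(1-3)[THEN symb_act_swap_flipD]
        by (simp add: distrib_right free_deriv_add free_deriv_gen_gen_mult fk_act_add)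
      then show ?thesis by (simp add: rel)
    qed
  qed
qed

lemma free_deriv_ideal:
  fixes x :: "'n::card2 symb word \<Rightarrow>\<^sub>0 'k::field"
  assumes "x \<in> two_sided_ideal fk_rels"
  shows "free_deriv e p x = 0"
  using assms
proof induction
  case (gen r u v)
  have rv: "abs_fk (r * v) = 0"
    using gen two_sided_ideal.gen[of r fk_rels 1 v] by (simp add: abs_fk_eq_zero_iff)
  show ?case
  proof (induction u rule: free_induct)
    case (single ss c)
    show ?case
    \<comment> \<open>Passing a letter changes the index, so \<open>p\<close> must vary; the other
      term of the recursion contains \<open>r * v\<close> undifferentiated and dies by
      \<open>rv\<close>.\<close>
    proof (induction ss arbitrary: p)
      case Nil
      \<comment> \<open>The scalar is central, so it joins the right factor and leaves the relation
        in front.\<close>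
      have "Poly_Mapping.single (Word []) c * r * v = r * (Poly_Mapping.single 0 c * v)"
        by (simp only: single_zero_commutes[of c r] mult.assoc flip: zero_word_def)
      then show ?case using free_deriv_rel_mult[OF gen, of e p] by simp
    next
      case (Cons s ss)
      then show ?case
        by (simp add: single_Word_Cons mult.assoc free_deriv_gen_mult abs_fk_mult[of _ "r * v"] rv
            del: mult_eq_0_iff)
    qed
  next
    case (add x y)
    then show ?case by (simp add: distrib_right free_deriv_add)
  qed
qed (simp_all add: free_deriv_add)

lift_definition fk_deriv :: "bool \<Rightarrow> 'n::card2 symb \<Rightarrow> ('n, 'k::field) fk \<Rightarrow> ('n, 'k) fk" is free_deriv
  by (metis free_deriv_diff free_deriv_ideal eq_iff_diff_eq_0)

lemma fk_deriv_add: "fk_deriv e p (f + f') = fk_deriv e p f + fk_deriv e p f'"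
  by transfer (rule free_deriv_add)

lemma fk_deriv_scale: "fk_deriv e p (fk_scale c f) = fk_scale c (fk_deriv e p f)"
proof transfer
  fix e c and p :: "'n::card2 symb" and x :: "'n symb word \<Rightarrow>\<^sub>0 'k::field"
  show "free_deriv e p (Poly_Mapping.single 0 c * x) = fk_scale c (free_deriv e p x)"
  proof (induction x rule: free_induct)
    case (single ss d)
    then show ?case by (simp add: mult_single free_deriv_single)
  next
    case (add x y)
    then show ?case by (simp add: distrib_left free_deriv_add fk.scale_right_distrib)
  qed
qed

lemma linear_fk_deriv: "Vector_Spaces.linear fk_scale fk_scale (fk_deriv e p)"
  by (simp add: fk_linear_iff fk_deriv_add fk_deriv_scale)

lemma fk_deriv_zero [simp]: "fk_deriv e p 0 = 0"
  using fk_deriv_add[of e p 0 0] by simp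

lemma fk_deriv_one [simp]: "fk_deriv e p 1 = 0"
proof -
  have "fk_deriv e p (abs_fk (Poly_Mapping.single (Word []) 1)) = 0"
    by (simp only: fk_deriv.abs_eq free_deriv_single) simp
  then show ?thesis by (simp add: abs_fk_single)
qed

lemma fk_deriv_gen_mult:
  "fk_deriv e p (fk_gen s * f) =
     fk_scale (pairing p s) f + fk_gen (move_gen e p s) * fk_deriv e (move_idx e p s) f"
proof (induction f rule: fk.abs_induct)
  case (1 y)
  then show ?case
    by (simp add: fk_gen_def[of s] fk_deriv.abs_eq free_deriv_gen_mult flip: abs_fk_mult)
qed

lemma fk_deriv_gen [simp]: "fk_deriv e p (fk_gen s) = fk_scale (pairing p s) 1"
  using fk_deriv_gen_mult[of e p s 1] by simp

text \<open>A derivation on the quotient detects the generator. This is what makes the signs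
  \<open>zeta\<close> unique.\<close>

lemma fk_gen_nonzero [simp]: "(fk_gen s :: ('n::card2, 'k::field) fk) \<noteq> 0"
proof
  assume "fk_gen s = (0 :: ('n, 'k) fk)"
  then have "fk_deriv True s (fk_gen s) = (0 :: ('n, 'k) fk)" by simp
  then show False by simp
qed

section \<open>Covariance and Leibniz rules for pair-indexed derivations\<close>

lemma fk_deriv_flip:
  fixes f :: "('n::card2, 'k::field) fk"
  shows "fk_deriv e (flip p) f = - fk_deriv e p f"
proof (induction f rule: fk_induct)
  case (word ss c)
  have "fk_deriv e (flip p) (fk_word ss) = (- fk_deriv e p (fk_word ss) :: ('n, 'k) fk)"
  proof (induction ss arbitrary: p)
    case (Cons s ss)
    have "move_gen e (flip p) s = move_gen e p s" "move_idx e (flip p) s = flip (move_idx e p s)"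
      by (simp_all add: move_gen_def move_idx_def)
    with Cons show ?case
      by (simp add: fk_deriv_gen_mult)
  qed simp
  then show ?case by (simp add: fk_deriv_scale fk.scale_minus_right)
qed (simp add: fk_deriv_add)

text \<open>Every ingredient of the recursion is equivariant: \<open>pairing\<close> is invariant,
  and the transposition of a moved pair is the conjugated transposition.\<close>

lemma fk_act_deriv:
  fixes f :: "('n::card2, 'k::field) fk"
  shows "fk_act g (fk_deriv e p f) = fk_deriv e (symb_act g p) (fk_act g f)"
proof (induction f rule: fk_induct)
  case (word ss c)
  have "fk_act g (fk_deriv e p (fk_word ss)) = fk_deriv e (symb_act g p) (fk_act g (fk_word ss) :: ('n, 'k) fk)"
  proof (induction ss arbitrary: p)
    case (Cons s ss)
    have "symb_act (swap_of (symb_act g x)) (symb_act g y) = symb_act g (symb_act (swap_of x) y)" for x y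
      by (simp add: swap_of_symb_act mult.assoc flip: symb_act_mult)
    then have "move_gen e (symb_act g p) (symb_act g s) = symb_act g (move_gen e p s)"
        "move_idx e (symb_act g p) (symb_act g s) = symb_act g (move_idx e p s)"
      by (simp_all add: move_gen_def move_idx_def)
    with Cons show ?case
      by (simp add: fk_deriv_gen_mult fk_act_mult fk_act_add fk_act_scale)
  qed simp
  then show ?case by (simp add: fk_deriv_scale fk_act_scale)
qed (simp add: fk_deriv_add fk_act_add)

abbreviation word_deg :: "'n::card2 symb list \<Rightarrow> 'n perm" where
  "word_deg ss \<equiv> prod_list (map swap_of ss)"

text \<open>Each letter passed acts on the index, the last one outermost; since transpositions are
  involutions, the total is the inverse of the degree.\<close>

lemma fk_deriv_True_word_mult:
  "fk_deriv True p (fk_word ss * f) =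
     fk_deriv True p (fk_word ss) * f
     + fk_word ss * fk_deriv True (symb_act (inverse (word_deg ss)) p) f"
proof (induction ss arbitrary: p)
  case (Cons s ss)
  then show ?case
    by (simp add: mult.assoc fk_deriv_gen_mult distrib_left distrib_right move_gen_def move_idx_def
        symb_act_mult add.assoc)
qed simp

text \<open>The index stays \<open>p\<close> and every letter passed is acted on by
  \<open>swap_of p\<close>, so the twist is an automorphism applied to the whole left
  factor.\<close>

lemma fk_deriv_False_mult:
  fixes f :: "('n::card2, 'k::field) fk"
  shows "fk_deriv False p (f * f') = fk_deriv False p f * f' + fk_act (swap_of p) f * fk_deriv False p f'"
proof (induction f rule: fk_induct)
  case (word ss c)
  have "fk_deriv False p (fk_word ss * f') =
      fk_deriv False p (fk_word ss) * f' + fk_act (swap_of p) (fk_word ss) * fk_deriv False p f'"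
    by (induction ss)
      (simp_all add: mult.assoc fk_deriv_gen_mult distrib_left distrib_right move_gen_def move_idx_def
        fk_act_mult add.assoc)
  then show ?case
    by (simp add: fk_deriv_scale fk_act_scale fk.scale_right_distrib)
qed (simp add: distrib_right fk_deriv_add fk_act_add algebra_simps)

section \<open>Two-cycles and homogeneous components\<close>

text \<open>The increasing pair behind a 2-cycle; its generator is \<open>fk_e a\<close>.\<close>

definition std_symb :: "'n::{card2,linorder} cyc2 \<Rightarrow> 'n symb" where
  "std_symb a = (THE s. swap_of s = perm_of a \<and> fst (Rep_symb s) < snd (Rep_symb s))"

lemma ex1_std_symb:
  fixes a :: "'n::{card2,linorder} cyc2"
  shows "\<exists>!s. swap_of s = perm_of a \<and> fst (Rep_symb s) < snd (Rep_symb s)"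
proof -
  obtain i j where a: "i \<noteq> j" "perm_of a = \<langle>i \<leftrightarrow> j\<rangle>"
    using perm_of[of a] by blast
  define s where "s = (if i < j then Abs_symb (i, j) else Abs_symb (j, i))"
  have s: "swap_of s = perm_of a" "fst (Rep_symb s) < snd (Rep_symb s)"
    using a by (cases i j rule: linorder_cases; simp add: s_def swap_sym)+
  moreover have "t = s" if "swap_of t = perm_of a" "fst (Rep_symb t) < snd (Rep_symb t)" for t
  proof -
    have "t = s \<or> t = flip s"
      using that s by (simp flip: swap_of_eq_iff)
    moreover have "t \<noteq> flip s"
      using that(2) s(2) by (cases s rule: symb_cases) auto
    ultimately show ?thesis by simp
  qed
  ultimately show ?thesis by blast
qed

lemma swap_of_std_symb [simp]: "swap_of (std_symb a) = perm_of a"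
  and std_symb_less: "fst (Rep_symb (std_symb a)) < snd (Rep_symb (std_symb a))"
  using theI'[OF ex1_std_symb[of a]] by (simp_all add: std_symb_def)

lemma std_symb_eq_iff [simp]: "std_symb a = std_symb b \<longleftrightarrow> a = b"
  by (metis perm_of_inject swap_of_std_symb)

lemma std_symb_neq_flip [simp]: "std_symb a \<noteq> flip (std_symb b)"
  by (metis flip_neq(1) perm_of_inject swap_of_flip swap_of_std_symb)

lemma pairing_std_symb: "pairing (std_symb a) (std_symb b) = (if a = b then 1 else 0)"
  by (auto simp: pairing_def)

lemma symb_std_cases:
  obtains a where "s = std_symb a" | a where "s = flip (std_symb a)"
proof -
  have "swap_of s \<in> {\<langle>i \<leftrightarrow> j\<rangle> | i j. i \<noteq> j}"
    by (cases s rule: symb_cases) auto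
  then obtain a where "swap_of s = perm_of a"
    by (rule perm_of_cases)
  then have "s = std_symb a \<or> s = flip (std_symb a)"
    by (simp flip: swap_of_eq_iff)
  then show thesis using that by blast
qed

lemma fk_e_eq: "fk_e a = fk_gen (std_symb a)"
  unfolding fk_e_def
proof (rule the_equality)
  obtain i j where ij: "i \<noteq> j" "std_symb a = Abs_symb (i, j)"
    by (rule symb_cases)
  then have "i < j" "perm_of a = \<langle>i \<leftrightarrow> j\<rangle>"
    using std_symb_less[of a] swap_of_std_symb[of a] by simp_all
  moreover have br: "fk_gen (Abs_symb (k, m)) = fk_br k m" for k m
    by (simp add: fk_gen_def free_gen_def fk_br.abs_eq free_br_def)
  ultimately show "\<exists>i j. i < j \<and> perm_of a = \<langle>i \<leftrightarrow> j\<rangle> \<and> fk_gen (std_symb a) = fk_br i j"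
    using ij by metis
  fix x assume "\<exists>i j. i < j \<and> perm_of a = \<langle>i \<leftrightarrow> j\<rangle> \<and> x = fk_br i j"
  then obtain k m where km: "k < m" "perm_of a = \<langle>k \<leftrightarrow> m\<rangle>" "x = fk_br k m" by blast
  then have "std_symb a = Abs_symb (k, m)"
    using ex1_std_symb[of a] std_symb_less[of a] swap_of_std_symb[of a]
    by (metis Rep_Abs_symb fst_conv less_irrefl snd_conv swap_of_Abs)
  with km show "x = fk_gen (std_symb a)" by (simp add: br)
qed

lemma symb_act_std_cases:
  "symb_act g (std_symb b) = std_symb (conj2 g b) \<or> symb_act g (std_symb b) = flip (std_symb (conj2 g b))"
  by (simp add: swap_of_symb_act perm_of_conj2 flip: swap_of_eq_iff)

text \<open>Acting by \<open>g\<close> on an increasing pair gives the increasing pair of the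
  conjugate or its reverse, and the odd \<open>pairing\<close> tells which. Uniqueness rests on
  \<open>fk_gen_nonzero\<close>.\<close>

lemma zeta_eq:
  fixes b :: "'n::{card2,linorder} cyc2"
  shows "(zeta g b :: 'k::field) = pairing (std_symb (conj2 g b)) (symb_act g (std_symb b))"
  unfolding zeta_def
proof (rule the_equality)
  let ?c = "std_symb (conj2 g b)"
  define z :: 'k where "z = pairing ?c (symb_act g (std_symb b))"
  have z: "z \<in> {1, -1}" "fk_gen (symb_act g (std_symb b)) = fk_scale z (fk_gen ?c :: ('n, 'k) fk)"
    using symb_act_std_cases[of g b] by (auto simp: z_def fk.scale_minus_left)
  then show "z \<in> {1, -1} \<and> fk_act g (fk_e b) = fk_scale z (fk_e (conj2 g b) :: ('n, 'k) fk)"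
    by (simp add: fk_e_eq)
  fix y :: 'k
  assume "y \<in> {1, -1} \<and> fk_act g (fk_e b) = fk_scale y (fk_e (conj2 g b) :: ('n, 'k) fk)"
  with z show "y = z"
    by (auto simp: fk_e_eq)
qed

lemma fk_gen_symb_act_std: "fk_gen (symb_act g (std_symb b)) = fk_scale (zeta g b) (fk_gen (std_symb (conj2 g b)))"
  using symb_act_std_cases[of g b] by (auto simp: zeta_eq fk.scale_minus_left)

text \<open>The source of the signs in the final formulas: a derivative is odd in its index, so
  normalising the moved pair costs \<open>zeta g b\<close>.\<close>

lemma fk_deriv_symb_act_std:
  "fk_deriv e (symb_act g (std_symb b)) f = fk_scale (zeta g b) (fk_deriv e (std_symb (conj2 g b)) f)"
  using symb_act_std_cases[of g b] by (auto simp: zeta_eq fk.scale_minus_left fk_deriv_flip)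

lemma pairing_symb_act_std:
  "pairing (std_symb a) (symb_act g (std_symb b)) = (if conj2 g b = a then zeta g b else 0)"
  using symb_act_std_cases[of g b] by (auto simp: zeta_eq pairing_std_symb)

lemma fk_mono_eq: "fk_mono as = fk_word (map std_symb as)"
  by (induction as) (simp_all add: fk_mono_def fk_e_eq)

text \<open>Reversing letters changes only the sign and keeps all transpositions, so words can
  replace monomials both for spanning and for degrees.\<close>

lemma fk_word_eq_mono:
  "\<exists>c as. (fk_word ss :: ('n::{card2,linorder}, 'k::field) fk) = fk_scale c (fk_mono as)
     \<and> map perm_of as = map swap_of ss"
proof (induction ss)
  case Nil
  have "(fk_word [] :: ('n, 'k) fk) = fk_scale 1 (fk_mono []) \<and> map perm_of [] = map swap_of []"
    by (simp add: fk_mono_def)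
  then show ?case by blast
next
  case (Cons s ss)
  then obtain c as where as: "(fk_word ss :: ('n, 'k) fk) = fk_scale c (fk_mono as)" "map perm_of as = map swap_of ss"
    by blast
  obtain a d where "(fk_gen s :: ('n, 'k) fk) = fk_scale d (fk_gen (std_symb a))" "perm_of a = swap_of s"
  proof (cases s rule: symb_std_cases)
    case (1 a)
    then show thesis using that[of 1 a] by simp
  next
    case (2 a)
    then show thesis using that[of "-1" a] by simp
  qed
  with as have "(fk_word (s # ss) :: ('n, 'k) fk) = fk_scale (c * d) (fk_mono (a # as)) \<and>
      map perm_of (a # as) = map swap_of (s # ss)"
    by (simp add: fk_mono_eq)
  then show ?case by blast
qed

lemma fk_word_in_deg: "(fk_word ss :: ('n::{card2,linorder}, 'k::field) fk) \<in> fk_deg (word_deg ss)"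
proof -
  obtain c as where as: "(fk_word ss :: ('n, 'k) fk) = fk_scale c (fk_mono as)" "map perm_of as = map swap_of ss"
    using fk_word_eq_mono by blast
  then have "(fk_mono as :: ('n, 'k) fk) \<in> fk_deg (word_deg ss)"
    unfolding fk_deg_def by (intro fk.span_base) force
  then show ?thesis
    unfolding as(1) fk_deg_def by (rule fk.span_scale)
qed

lemma fk_deg_add: "f \<in> fk_deg h \<Longrightarrow> f' \<in> fk_deg h \<Longrightarrow> f + f' \<in> fk_deg h"
  and fk_deg_scale: "f \<in> fk_deg h \<Longrightarrow> fk_scale c f \<in> fk_deg h"
  and fk_deg_zero: "0 \<in> fk_deg h"
  unfolding fk_deg_def by (rule fk.span_add fk.span_scale fk.span_zero; assumption?)+

lemma fk_deg_induct [consumes 1, case_names zero step]: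
  assumes "f \<in> fk_deg h"
    and "P 0"
    and "\<And>c ss f. word_deg ss = h \<Longrightarrow> f \<in> fk_deg h \<Longrightarrow> P f \<Longrightarrow> P (fk_scale c (fk_word ss) + f)"
  shows "P f"
proof -
  have "f \<in> fk_deg h \<and> P f"
    using assms(1)[unfolded fk_deg_def]
  proof (induction rule: fk.span_induct_alt)
    case base
    then show ?case using assms(2) fk_deg_zero by blast
  next
    case (step c x y)
    then obtain as where "x = fk_mono as" "prod_list (map perm_of as) = h" by blast
    then have "x = fk_word (map std_symb as)" "word_deg (map std_symb as) = h"
      by (simp_all add: fk_mono_eq comp_def)
    with step show ?case
      using assms(3) fk_word_in_deg by (metis fk_deg_add fk_deg_scale)
  qed
  then show ?thesis ..
qed

lemma fk_gen_mult_deg: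
  fixes f :: "('n::{card2,linorder}, 'k::field) fk"
  shows "f \<in> fk_deg h \<Longrightarrow> fk_gen s * f \<in> fk_deg (swap_of s * h)"
proof (induction rule: fk_deg_induct)
  case zero
  show ?case by (simp add: fk_deg_zero)
next
  case (step c ss f)
  then show ?case
    using fk_word_in_deg[of "s # ss", where 'k = 'k] by (simp add: distrib_left fk_deg_add fk_deg_scale)
qed

text \<open>If the derivative hits \<open>s\<close>, the transpositions of \<open>p\<close> and
  \<open>s\<close> agree and cancel; if it passes, the braiding preserves the product of the two
  transpositions.\<close>

lemma fk_deriv_in_deg:
  fixes f :: "('n::{card2,linorder}, 'k::field) fk"
  assumes "f \<in> fk_deg h"
  shows "fk_deriv e p f \<in> fk_deg (swap_of p * h)"
proof -
  have word: "(fk_deriv e p (fk_word ss) :: ('n, 'k) fk) \<in> fk_deg (swap_of p * word_deg ss)" for ss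
  proof (induction ss arbitrary: p)
    case Nil
    show ?case by (simp add: fk_deg_zero)
  next
    case (Cons s ss)
    have "swap_of p * (swap_of s * word_deg ss) = word_deg ss" if "pairing p s \<noteq> (0 :: 'k)"
      using pairing_nonzero[OF that] by simp
    then have "fk_scale (pairing p s) (fk_word ss :: ('n, 'k) fk) \<in> fk_deg (swap_of p * (swap_of s * word_deg ss))"
      using fk_word_in_deg[of ss, where 'k = 'k] by (cases "pairing p s = (0 :: 'k)") (auto simp: fk_deg_zero fk_deg_scale)
    moreover have "swap_of (move_gen e p s) * (swap_of (move_idx e p s) * g) = swap_of p * (swap_of s * g)" for g
      by (simp add: move_gen_def move_idx_def swap_of_symb_act mult.assoc)
    then have "fk_gen (move_gen e p s) * fk_deriv e (move_idx e p s) (fk_word ss :: ('n, 'k) fk)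
        \<in> fk_deg (swap_of p * (swap_of s * word_deg ss))"
      using fk_gen_mult_deg[OF Cons.IH] by metis
    ultimately show ?case
      by (simp add: fk_deriv_gen_mult fk_deg_add)
  qed
  from assms show ?thesis
  proof (induction rule: fk_deg_induct)
    case zero
    show ?case by (simp add: fk_deg_zero)
  next
    case (step c ss f)
    then show ?case using word[of ss] by (simp add: fk_deriv_add fk_deriv_scale fk_deg_add fk_deg_scale)
  qed
qed

section \<open>Partial derivatives\<close>

text \<open>The Leibniz rule for one appended letter, with the action transferred from the index to
  that letter to match the shape of a braid chain.\<close>

lemma fk_deriv_snoc_True:
  fixes a :: "'n::{card2,linorder} cyc2"
  shows "fk_deriv True (std_symb a) (fk_mono (u @ [x]) :: ('n, 'k::field) fk) =
     fk_deriv True (std_symb a) (fk_mono u) * fk_e x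
     + (if conj2 (prod_list (map perm_of u)) x = a
        then fk_scale (zeta (prod_list (map perm_of u)) x) (fk_mono u) else 0)"
  by (simp add: fk_mono_eq fk_deriv_True_word_mult fk_e_eq pairing_symb_act_left
      pairing_symb_act_std comp_def)

lemma fk_deriv_snoc_False:
  "fk_deriv False (std_symb a) (fk_mono (u @ [x])) =
     fk_deriv False (std_symb a) (fk_mono u) * fk_e x
     + (if x = a then fk_act (perm_of a) (fk_mono u) else 0)"
  by (simp add: fk_mono_eq fk_deriv_False_mult fk_e_eq pairing_std_symb)

lemma fk_act_mono:
  "fk_act g (fk_mono u) = fk_scale (\<Prod>b\<leftarrow>u. zeta g b) (fk_mono (map (conj2 g) u))"
  by (induction u) (simp_all add: fk_mono_eq fk_act_mult fk_gen_symb_act_std)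

section \<open>Braid chains in coordinates\<close>

lemma act_at_single:
  "act_at (length u) \<Phi> (Poly_Mapping.single (u @ y # x # v) c) =
     Poly_Mapping.map ((*) c) (lin_ext (\<lambda>(y', x'). Poly_Mapping.single (u @ y' # x' # v) 1)
       (\<Phi> (Poly_Mapping.single (y, x) 1)))"
  by (simp add: act_at_def lin_ext_single nth_append list_update_append)

lemma conj2_mult: "conj2 (g * h) b = conj2 g (conj2 h b)"
  by (simp add: perm_of_conj2 mult.assoc flip: perm_of_inject)

lemma conj2_one [simp]: "conj2 1 b = b"
  by (simp add: perm_of_conj2 flip: perm_of_inject)

lemma zeta_one [simp]: "zeta 1 b = 1"
  by (simp add: zeta_eq pairing_std_symb)

lemma zeta_mult:
  fixes b :: "'n::{card2,linorder} cyc2"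
  shows "zeta (g * h) b = zeta g (conj2 h b) * (zeta h b :: 'k::field)"
proof -
  have "fk_scale (zeta (g * h) b) (fk_gen (std_symb (conj2 (g * h) b)))
      = fk_scale (zeta h b) (fk_act g (fk_gen (std_symb (conj2 h b)) :: ('n, 'k) fk))"
    by (metis fk_act_gen fk_act_scale fk_gen_symb_act_std symb_act_mult)
  then show ?thesis
    by (simp add: conj2_mult fk_gen_symb_act_std mult.commute)
qed

lemma perm_of_squared [simp]: "perm_of a * perm_of a = 1"
proof -
  obtain i j where "perm_of a = \<langle>i \<leftrightarrow> j\<rangle>"
    using perm_of[of a] by blast
  then show ?thesis by simp
qed

lemma fk_Psi_single:
  "fk_Psi (Poly_Mapping.single (a, b) c) =
     Poly_Mapping.single (conj2 (perm_of a) b, a) (c * zeta (perm_of a) b)"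
  by (simp add: fk_Psi_def lin_ext_single)

text \<open>The rightmost crossing acts first, so \<open>x\<close> passes the last letter of
  \<open>u\<close> first. That letter then joins the tail, hence the reverse induction with
  \<open>x\<close>, \<open>v\<close>, \<open>c\<close> varying.\<close>

lemma braid_chain_Psi:
  "braid_chain (length u) fk_Psi (Poly_Mapping.single (u @ x # v) c) =
     Poly_Mapping.single (conj2 (prod_list (map perm_of u)) x # u @ v)
       (c * zeta (prod_list (map perm_of u)) x)"
proof (induction u arbitrary: x v c rule: rev_induct)
  case (snoc y u)
  have "act_at (length u) fk_Psi (Poly_Mapping.single (u @ y # x # v) c) =
      Poly_Mapping.single (u @ conj2 (perm_of y) x # y # v) (c * zeta (perm_of y) x)"
    by (simp add: act_at_single fk_Psi_single lin_ext_single)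
  then show ?case
    by (simp add: snoc.IH conj2_mult zeta_mult mult_ac)
qed simp

text \<open>The crossing is undone by acting once more with the same transposition; the two signs
  multiply to \<open>zeta\<close> at the identity.\<close>

lemma inv_fk_Psi:
  "inv (fk_Psi :: ('n::{card2,linorder} cyc2 \<times> 'n cyc2 \<Rightarrow>\<^sub>0 'k::field) \<Rightarrow> _) =
     lin_ext (\<lambda>(a, b). Poly_Mapping.single (b, conj2 (perm_of b) a) (zeta (perm_of b) a))"
  (is "_ = ?G")
proof (rule inv_unique_comp)
  have conj: "conj2 (perm_of a) (conj2 (perm_of a) b) = b" for a b :: "'n cyc2"
    by (simp flip: conj2_mult)
  have zeta: "zeta (perm_of a) (conj2 (perm_of a) b) * zeta (perm_of a) b = (1 :: 'k)" for a b :: "'n cyc2"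
    by (simp flip: zeta_mult)
  have zeta': "zeta (perm_of a) b * zeta (perm_of a) (conj2 (perm_of a) b) = (1 :: 'k)" for a b :: "'n cyc2"
    using zeta[of a b] by (simp add: mult.commute)
  show "fk_Psi \<circ> ?G = id"
  proof
    fix x :: "'n cyc2 \<times> 'n cyc2 \<Rightarrow>\<^sub>0 'k"
    show "(fk_Psi \<circ> ?G) x = id x"
      by (induction x rule: poly_mapping_single_induct)
        (auto simp: fk_Psi_def lin_ext_single lin_ext_add conj zeta' mult.assoc)
  qed
  show "?G \<circ> fk_Psi = id"
  proof
    fix x :: "'n cyc2 \<times> 'n cyc2 \<Rightarrow>\<^sub>0 'k"
    show "(?G \<circ> fk_Psi) x = id x"
      by (induction x rule: poly_mapping_single_induct)
        (auto simp: fk_Psi_def lin_ext_single lin_ext_add conj zeta' mult.assoc)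
  qed
qed

text \<open>Here \<open>x\<close> travels unchanged and conjugates each letter it passes.\<close>

lemma braid_chain_Psi_inv:
  "braid_chain (length u) (inv fk_Psi) (Poly_Mapping.single (u @ x # v) c) =
     Poly_Mapping.single (x # map (conj2 (perm_of x)) u @ v) (c * (\<Prod>b\<leftarrow>u. zeta (perm_of x) b))"
proof (induction u arbitrary: v c rule: rev_induct)
  case (snoc y u)
  have "act_at (length u) (inv fk_Psi) (Poly_Mapping.single (u @ y # x # v) c) =
      Poly_Mapping.single (u @ x # conj2 (perm_of x) y # v) (c * zeta (perm_of x) y)"
    by (simp add: act_at_single inv_fk_Psi lin_ext_single)
  then show ?case
    by (simp add: snoc.IH mult_ac)
qed simp

text \<open>
  The hypotheses say that the \<open>r\<close>-th summand of the braided integer moves the \<open>r\<close>-th factor to the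
  front, and that the Leibniz rule of \<open>D\<close> for appending a factor produces exactly this summand.
\<close>

lemma is_partialI:
  fixes D :: "('n::{card2,linorder}, 'k::field) fk \<Rightarrow> ('n, 'k) fk"
  assumes "Vector_Spaces.linear fk_scale fk_scale D" "D 1 = 0"
    and chain: "\<And>u x v. braid_chain (length u) \<Phi> (Poly_Mapping.single (u @ x # v) 1) =
      Poly_Mapping.single (moved u x # rest u x @ v) (coef u x)"
    and len: "\<And>u x. length (rest u x) = length u"
    and snoc: "\<And>u x. D (fk_mono (u @ [x])) = D (fk_mono u) * fk_e x
      + (if moved u x = a then fk_scale (coef u x) (fk_mono (rest u x)) else 0)"
  shows "is_partial \<Phi> a D"
proof -
  \<comment> \<open>The share of the chain moving factor \<open>r\<close>: the prefix is altered,
    the tail after position \<open>r\<close> is untouched.\<close>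
  define summand where "summand as r =
    (let u = take r as; x = as ! r in
      if moved u x = a then fk_scale (coef u x) (fk_mono (rest u x @ drop (Suc r) as)) else 0 :: ('n, 'k) fk)"
    for as r
  have mono_append: "fk_mono (u @ v) = fk_mono u * (fk_mono v :: ('n, 'k) fk)" for u v
    by (simp add: fk_mono_def)
  have D: "D (fk_mono as) = (\<Sum>r<length as. summand as r)" for as
  proof (induction as rule: rev_induct)
    case Nil
    then show ?case using assms(2) by (simp add: fk_mono_def)
  next
    case (snoc x as)
    \<comment> \<open>An appended letter lies in the untouched tail of every old summand and creates
      exactly one new one.\<close>
    have "summand (as @ [x]) r = summand as r * fk_e x" if "r < length as" for r
      using that by (simp add: summand_def Let_def nth_append mono_append) (simp add: fk_mono_def mult.assoc)
    moreover have "summand (as @ [x]) (length as) =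
        (if moved as x = a then fk_scale (coef as x) (fk_mono (rest as x)) else 0)"
      by (simp add: summand_def)
    ultimately show ?case
      by (simp add: assms(5) snoc.IH sum_distrib_right)
  qed
  \<comment> \<open>The sum in \<open>is_partial\<close> would be 0 by default over an infinite
    index set, so the 2-cycles are shown to be finite in number, as images of pairs of
    points.\<close>
  have "range (perm_of :: 'n cyc2 \<Rightarrow> _) \<subseteq> range (\<lambda>(i, j). \<langle>i \<leftrightarrow> j\<rangle>)"
  proof (rule image_subsetI)
    fix c :: "'n cyc2"
    obtain i j where "perm_of c = \<langle>i \<leftrightarrow> j\<rangle>"
      using perm_of[of c] by blast
    then show "perm_of c \<in> range (\<lambda>(i, j). \<langle>i \<leftrightarrow> j\<rangle>)"
      by (auto simp: image_iff)
  qed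
  then have "finite (range (perm_of :: 'n cyc2 \<Rightarrow> _))"
    by (rule finite_subset) simp
  then have "finite (UNIV :: 'n cyc2 set)"
    by (rule finite_imageD) (simp add: inj_def perm_of_inject)
  then have fin: "finite {bs :: 'n cyc2 list. length bs = m}" for m
    using finite_lists_length_eq[of UNIV m] by simp
  have "(\<Sum>bs | Suc (length bs) = length as.
      fk_scale (mat_coeff (braided_int (length as) \<Phi>) (a # bs) as) (fk_mono bs)) = D (fk_mono as)"
    if "as \<noteq> []" for as
  proof -
    let ?B = "{bs :: 'n cyc2 list. Suc (length bs) = length as}"
    have "?B = {bs. length bs = length as - 1}"
      using that by (cases as) auto
    then have B: "finite ?B"
      using fin by simp
    have "(\<Sum>bs\<in>?B. fk_scale (Poly_Mapping.lookup (braid_chain r \<Phi> (Poly_Mapping.single as 1)) (a # bs))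
        (fk_mono bs)) = summand as r" if r: "r < length as" for r
    proof -
      let ?u = "take r as" and ?x = "as ! r" and ?v = "drop (Suc r) as"
      have "as = ?u @ ?x # ?v" "length ?u = r"
        using r by (simp_all add: id_take_nth_drop)
      then have ch: "braid_chain r \<Phi> (Poly_Mapping.single as 1) =
          Poly_Mapping.single (moved ?u ?x # rest ?u ?x @ ?v) (coef ?u ?x)"
        using chain[of ?u ?x ?v] by simp
      have "rest ?u ?x @ ?v \<in> ?B"
        using r by (simp add: len)
      have "(\<Sum>bs\<in>?B. fk_scale (Poly_Mapping.lookup (braid_chain r \<Phi> (Poly_Mapping.single as 1)) (a # bs))
          (fk_mono bs)) = (\<Sum>bs\<in>?B. if bs = rest ?u ?x @ ?v then summand as r else 0)"
        by (rule sum.cong) (auto simp: ch lookup_single when_def summand_def Let_def)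
      also have "\<dots> = summand as r"
        using B \<open>rest ?u ?x @ ?v \<in> ?B\<close> by (subst sum.delta) simp_all
      finally show ?thesis .
    qed
    then have "D (fk_mono as) = (\<Sum>r<length as. \<Sum>bs\<in>?B.
        fk_scale (Poly_Mapping.lookup (braid_chain r \<Phi> (Poly_Mapping.single as 1)) (a # bs)) (fk_mono bs))"
      by (simp add: D)
    then show ?thesis
      by (subst (asm) sum.swap) (simp add: mat_coeff_def braided_int_def lookup_sum fk.scale_sum_left)
  qed
  then show ?thesis
    using assms(1,2) by (simp add: is_partial_def)
qed

lemma is_partial_fk_deriv_True: "is_partial fk_Psi a (fk_deriv True (std_symb a))"
  by (rule is_partialI[where moved = "\<lambda>u. conj2 (prod_list (map perm_of u))" and rest = "\<lambda>u x. u"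
        and coef = "\<lambda>u. zeta (prod_list (map perm_of u))"])
    (simp_all add: linear_fk_deriv braid_chain_Psi fk_deriv_snoc_True)

lemma is_partial_fk_deriv_False: "is_partial (inv fk_Psi) a (fk_deriv False (std_symb a))"
  by (rule is_partialI[where moved = "\<lambda>u x. x" and rest = "\<lambda>u x. map (conj2 (perm_of x)) u"
        and coef = "\<lambda>u x. \<Prod>b\<leftarrow>u. zeta (perm_of x) b"])
    (simp_all add: linear_fk_deriv braid_chain_Psi_inv fk_deriv_snoc_False fk_act_mono)

lemma is_partial_unique:
  fixes D D' :: "('n::{card2,linorder}, 'k::field) fk \<Rightarrow> ('n, 'k) fk"
  assumes "is_partial \<Phi> a D" "is_partial \<Phi> a D'"
  shows "D = D'"
proof
  have lin: "D (x + y) = D x + D y" "D' (x + y) = D' x + D' y"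
      "D (fk_scale c x) = fk_scale c (D x)" "D' (fk_scale c x) = fk_scale c (D' x)" for c x y
    using assms by (simp_all add: is_partial_def fk_linear_iff)
  have mono: "D (fk_mono as) = D' (fk_mono as)" for as
    using assms by (cases "as = []") (simp_all add: is_partial_def fk_mono_def)
  fix f
  show "D f = D' f"
  proof (induction f rule: fk_induct)
    case (word ss c)
    obtain d as where "(fk_word ss :: ('n, 'k) fk) = fk_scale d (fk_mono as)"
      using fk_word_eq_mono by blast
    then show ?case by (simp add: lin mono)
  qed (simp add: lin)
qed

lemma fk_D_eq: "fk_D a = fk_deriv True (std_symb a)"
  unfolding fk_D_def
  by (rule the_equality) (use is_partial_fk_deriv_True is_partial_unique in blast)+

lemma fk_Dbar_eq: "fk_Dbar a = fk_deriv False (std_symb a)"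
  unfolding fk_Dbar_def
  by (rule the_equality) (use is_partial_fk_deriv_False is_partial_unique in blast)+

text \<open>The twist in the word rule depends on the word only through its degree, so the rule
  extends linearly over a homogeneous component.\<close>

lemma fk_deriv_True_mult_deg:
  fixes f f' :: "('n::{card2,linorder}, 'k::field) fk"
  assumes "f \<in> fk_deg h"
  shows "fk_deriv True p (f * f') =
    fk_deriv True p f * f' + f * fk_deriv True (symb_act (inverse h) p) f'"
  using assms
proof (induction rule: fk_deg_induct)
  case (step c ss f)
  then show ?case
    by (simp add: distrib_right fk_deriv_add fk_deriv_scale fk_deriv_True_word_mult
        fk.scale_right_distrib algebra_simps)
qed simp

theorem corollary6p6:
  fixes a b :: "'n::{card2,linorder} cyc2"
    and g h :: "'n perm"
    and f f' :: "('n, 'k::field_char_0) fk"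
  shows
    "(f \<in> fk_deg h \<longrightarrow> fk_D a f \<in> fk_deg (perm_of a * h)) \<and>
     fk_act g (fk_D a f) = fk_scale (zeta g a) (fk_D (conj2 g a) (fk_act g f)) \<and>
     (f \<in> fk_deg h \<longrightarrow> fk_Dbar a f \<in> fk_deg (perm_of a * h)) \<and>
     fk_act g (fk_Dbar a f) = fk_scale (zeta g a) (fk_Dbar (conj2 g a) (fk_act g f)) \<and>
     fk_D a (fk_e b) = (if a = b then 1 else 0 :: ('n, 'k) fk) \<and>
     fk_Dbar a (fk_e b) = (if a = b then 1 else 0 :: ('n, 'k) fk) \<and>
     (f \<in> fk_deg h \<longrightarrow>
        fk_D a (f * f') =
          fk_D a f * f' + f * fk_scale (zeta (inverse h) a) (fk_D (conj2 (inverse h) a) f')) \<and>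
     fk_Dbar a (f * f') = fk_Dbar a f * f' + fk_act (perm_of a) f * fk_Dbar a f'"
proof (intro conjI impI)
  have act: "fk_act g (fk_deriv e (std_symb a) f) =
      fk_scale (zeta g a) (fk_deriv e (std_symb (conj2 g a)) (fk_act g f))" for e
    by (simp add: fk_act_deriv fk_deriv_symb_act_std)
  show "fk_act g (fk_D a f) = fk_scale (zeta g a) (fk_D (conj2 g a) (fk_act g f))"
    and "fk_act g (fk_Dbar a f) = fk_scale (zeta g a) (fk_Dbar (conj2 g a) (fk_act g f))"
    by (simp_all only: fk_D_eq fk_Dbar_eq act)
  show "fk_D a (fk_e b) = (if a = b then 1 else 0 :: ('n, 'k) fk)"
    and "fk_Dbar a (fk_e b) = (if a = b then 1 else 0 :: ('n, 'k) fk)"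
    by (simp_all add: fk_D_eq fk_Dbar_eq fk_e_eq pairing_std_symb)
  show "fk_Dbar a (f * f') = fk_Dbar a f * f' + fk_act (perm_of a) f * fk_Dbar a f'"
    by (simp add: fk_Dbar_eq fk_deriv_False_mult)
  assume f: "f \<in> fk_deg h"
  show "fk_D a f \<in> fk_deg (perm_of a * h)" "fk_Dbar a f \<in> fk_deg (perm_of a * h)"
    using fk_deriv_in_deg[OF f, of _ "std_symb a"] by (simp_all add: fk_D_eq fk_Dbar_eq)
  show "fk_D a (f * f') =
      fk_D a f * f' + f * fk_scale (zeta (inverse h) a) (fk_D (conj2 (inverse h) a) f')"
    using fk_deriv_True_mult_deg[OF f, of "std_symb a" f'] by (simp add: fk_D_eq fk_deriv_symb_act_std)
qed

end
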